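(* Let $\phi(z)=\sum_{n\geq1}\phi_nz^n$ be a power series with real coefficients, $f(z)=z(1-\phi(z))=\sum_{n\geq1}f_nz^n$, and for $0<q<1$ let $g(z)=\sum_{n\geq0}g_nz^n$ be the formal power series with $g_0=0$ solving $\sum_{n\geq 1} f_n\, g(z)g(z/q)\cdots g(z/q^{n-1})=z$. Assume: (i) $\phi_i\geq 0$ for all $i\geq 1$; (ii) $\zeta=\min\{x>0:\phi(x)=1\}$ exists; (iii) for every nonnegative integer $j$, $\lim_{n\to\infty}\phi_{j+n}/\phi_n$ exists in $[0,\infty)$; (iv) the sequence $\bigl([z^n]\frac{1}{1-\phi(\zeta z)}\bigr)_{n\geq 0}$ is regularly varying with index $\rho-1\in(-1,0]$. Then for every $q\in(0,1)$, the sequence $$a_n(q)=\zeta^n\, n\Bigl(1-\phi\Bigl(\zeta\Bigl(1-\frac1n\Bigr)\Bigr)\Bigr)\,q^{\binom n2}g_n$$ converges to $$L(q)=\frac{\zeta}{\Gamma(\rho)\prod_{j\geq1}\bigl(1-\phi(\zeta q^j)\bigr)}$$ in each of the three modes: in limit infimum, except on a set of integers of density $0$, and coefficientwise (all for $q$ in $A=(0,1)$).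
   Context: A sequence $(a_n)$ is regularly varying with index $\alpha$ if the function $t\mapsto a_{\lfloor t\rfloor}$ satisfies $\lim_{t\to\infty}a_{\lfloor \lambda t\rfloor}/a_{\lfloor t\rfloor}=\lambda^\alpha$ for every $\lambda>0$. Each $q^{\binom n2}g_n$ is a polynomial in $q$, so $a_n(q)$ is a polynomial in $q$, and $L(q)$ is viewed as a power series in $q$. For a sequence of polynomials $a_n(q)$, a power series $L(q)$ and a set $A$: (1) convergence in limit infimum means $\liminf_{n\to\infty}a_n(q)=L(q)$ for every $q\in A$; (2) convergence except on a set of integers of density $0$ means that for every $\delta>0$ and every $q\in A$, $\lim_{n\to\infty}\frac1n\#\{1\leq i\leq n: |a_i(q)-L(q)|\geq\delta\}=0$; (3) coefficientwise convergence means $\lim_{n\to\infty}[q^j]a_n=[q^j]L$ for every fixed integer $j\geq0$, where $[q^j]$ denotes the coefficient of $q^j$. *)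

theory Defs
  imports "HOL-Analysis.Analysis"
begin

definition regularly_varying :: "(nat \<Rightarrow> real) \<Rightarrow> real \<Rightarrow> bool" where
  "regularly_varying a \<alpha> \<longleftrightarrow>
     (\<forall>s>0. ((\<lambda>t::real. a (nat \<lfloor>s * t\<rfloor>) / a (nat \<lfloor>t\<rfloor>)) \<longlongrightarrow> s powr \<alpha>) at_top)"

definition fps_dilate :: "real \<Rightarrow> real fps \<Rightarrow> real fps" where
  "fps_dilate c h = fps_compose h (fps_const c * fps_X)"

text \<open>
  The series \<open>g\<close> with zero constant term that solves
  \<open>f\<^sub>1 g(z) + f\<^sub>2 g(z) g(z/q) + f\<^sub>3 g(z) g(z/q) g(z/q\<^sup>2) + \<dots> = z\<close>.
  The infinite sum converges in the X-adic topology that the library puts on formal power series,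
  because the term with coefficient \<open>f\<^sub>k\<close> is divisible by \<open>z\<^sup>k\<close>.
\<close>
definition is_q_inverse :: "real \<Rightarrow> real fps \<Rightarrow> real fps \<Rightarrow> bool" where
  "is_q_inverse q f g \<longleftrightarrow>
     fps_nth g 0 = 0 \<and>
     (\<lambda>n. fps_const (fps_nth f (Suc n)) * (\<Prod>i\<le>n. fps_dilate (1 / q ^ i) g)) sums fps_X"

text \<open>
  Convergence of the series is part of the condition \<open>\<phi>(x) = 1\<close>: \<open>eval_fps\<close> has an unspecified
  value at points where the series diverges.
\<close>
definition is_min_unit_root :: "real fps \<Rightarrow> real \<Rightarrow> bool" where
  "is_min_unit_root \<phi> \<zeta> \<longleftrightarrow>
     (let S = {x::real. x > 0 \<and> (\<lambda>n. fps_nth \<phi> n * x ^ n) sums 1}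
      in \<zeta> \<in> S \<and> (\<forall>x\<in>S. \<zeta> \<le> x))"

text \<open>
  The quotients must be genuinely defined for all large \<open>n\<close>. Without the first conjunct the
  convention \<open>x / 0 = 0\<close> would admit, for instance, every polynomial.
\<close>
definition has_ratio_limits :: "(nat \<Rightarrow> real) \<Rightarrow> bool" where
  "has_ratio_limits c \<longleftrightarrow>
     (\<forall>\<^sub>F n in sequentially. c n \<noteq> 0) \<and>
     (\<forall>j. \<exists>l\<ge>0. (\<lambda>n. c (j + n) / c n) \<longlonglongrightarrow> l)"

definition converges_liminf :: "(nat \<Rightarrow> real poly) \<Rightarrow> real fps \<Rightarrow> real set \<Rightarrow> bool" where
  "converges_liminf a L A \<longleftrightarrow>
     (\<forall>q\<in>A. liminf (\<lambda>n. ereal (poly (a n) q)) = ereal (eval_fps L q))"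

definition converges_off_density_zero :: "(nat \<Rightarrow> real poly) \<Rightarrow> real fps \<Rightarrow> real set \<Rightarrow> bool" where
  "converges_off_density_zero a L A \<longleftrightarrow>
     (\<forall>\<delta>>0. \<forall>q\<in>A.
        (\<lambda>n. real (card {i \<in> {1..n}. \<bar>poly (a i) q - eval_fps L q\<bar> \<ge> \<delta>}) / real n) \<longlonglongrightarrow> 0)"

definition converges_coeffwise :: "(nat \<Rightarrow> real poly) \<Rightarrow> real fps \<Rightarrow> bool" where
  "converges_coeffwise a L \<longleftrightarrow> (\<forall>j. (\<lambda>n. coeff (a n) j) \<longlonglongrightarrow> fps_nth L j)"

definition a_fun :: "real fps \<Rightarrow> real \<Rightarrow> (real \<Rightarrow> real fps) \<Rightarrow> nat \<Rightarrow> real \<Rightarrow> real" where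
  "a_fun \<phi> \<zeta> g n q =
     \<zeta> ^ n * real n * (1 - eval_fps \<phi> (\<zeta> * (1 - 1 / real n))) * q ^ (n choose 2) * fps_nth (g q) n"

definition L_fun :: "real fps \<Rightarrow> real \<Rightarrow> real \<Rightarrow> real \<Rightarrow> real" where
  "L_fun \<phi> \<zeta> \<rho> q = \<zeta> / (Gamma \<rho> * (\<Prod>j. 1 - eval_fps \<phi> (\<zeta> * q ^ Suc j)))"

text \<open>
  The polynomial \<open>a n\<close> and the power series \<open>L\<close> that represent given functions of \<open>q\<close> on \<open>(0,1)\<close>.
  Both are uniquely determined by the functions.
\<close>
definition represents_poly :: "real poly \<Rightarrow> (real \<Rightarrow> real) \<Rightarrow> bool" where
  "represents_poly p u \<longleftrightarrow> (\<forall>q\<in>{0<..<1}. poly p q = u q)"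

definition represents_fps :: "real fps \<Rightarrow> (real \<Rightarrow> real) \<Rightarrow> bool" where
  "represents_fps F u \<longleftrightarrow> (\<forall>q\<in>{0<..<1}. (\<lambda>j. fps_nth F j * q ^ j) sums u q)"

end

theory Submission
  imports Defs
begin

text \<open>
  Let \<open>b\<^sub>n = q\<^bsup>n choose 2\<^esup> g\<^sub>n\<close>. The inverse of the \<open>q\<close>-substitution \<open>z\<^sup>n \<mapsto> g(z) g(z/q) \<dots> g(z/q\<^sup>n\<^sup>-\<^sup>1)\<close>
  is \<open>z\<^sup>n \<mapsto> f(z) f(qz) \<dots> f(q\<^sup>n\<^sup>-\<^sup>1z)\<close>, so the nonlinear equation for \<open>g\<close> is equivalent to the linear one
  \<open>\<Sum>\<^sub>n g\<^sub>n f(z) f(qz) \<dots> f(q\<^sup>n\<^sup>-\<^sup>1z) = z\<close>. With the solution \<open>P\<close> of \<open>(1 - \<phi>(z)) P(z) = P(qz)\<close>, \<open>P(0) = 1\<close>,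
  i.e. \<open>P(z) = \<Prod>\<^bsub>i\<ge>0\<^esub> 1 / (1 - \<phi>(q\<^sup>iz))\<close>, it reads \<open>\<Sum>\<^sub>n b\<^sub>n z\<^sup>n P(q\<^sup>nz) = z P(z)\<close>, which shows that
  \<open>b\<^sub>n\<close> and \<open>[z\<^sup>n\<^sup>-\<^sup>1]P\<close> differ by an exponentially smaller term. Since \<open>P(z) = P(qz) / (1 - \<phi>(z))\<close>, where
  \<open>P(qz)\<close> has radius of convergence greater than \<open>\<zeta>\<close>, \<open>\<zeta>\<^sup>n b\<^sub>n\<close> is asymptotic to \<open>\<zeta> P(q\<zeta>) u\<^sub>n\<close> for the regularly
  varying sequence \<open>u\<^sub>n = [z\<^sup>n] 1 / (1 - \<phi>(\<zeta>z))\<close>. The Abelian half of Karamata's theorem, in the form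
  \<open>1 / (1 - \<phi>(\<zeta>(1 - 1/n))) \<sim> \<Gamma>(\<rho>) n u\<^sub>n\<close>, then gives pointwise convergence of the whole sequence. The
  coefficients of the polynomials are nonnegative, so pointwise convergence on \<open>(0,1)\<close> forces
  coefficientwise convergence.
\<close>

section \<open>Duality of the q-inverse\<close>

lemma fps_dilate_nth [simp]: "fps_nth (fps_dilate c h) n = c ^ n * fps_nth h n"
  by (simp add: fps_dilate_def fps_compose_linear)

lemma fps_dilate_mult: "fps_dilate c (a * b) = fps_dilate c a * fps_dilate c b"
  by (simp add: fps_dilate_def fps_compose_mult_distrib)

lemma fps_dilate_dilate: "fps_dilate c (fps_dilate d h) = fps_dilate (c * d) h"
  by (rule fps_ext) (simp add: power_mult_distrib)

lemma fps_dilate_one [simp]: "fps_dilate c 1 = 1"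
  by (rule fps_ext) auto

lemma fps_dilate_1 [simp]: "fps_dilate 1 h = h"
  by (rule fps_ext) simp

text \<open>Used with \<open>c = 1 / q\<close> for the products of \<open>g\<close> in the defining
  equation and with \<open>c = q\<close> for the products of \<open>f\<close> in the dual
  one.\<close>

definition fps_qprod :: "real \<Rightarrow> real fps \<Rightarrow> nat \<Rightarrow> real fps" where
  "fps_qprod c h n = (\<Prod>i<n. fps_dilate (c ^ i) h)"

lemma fps_qprod_0 [simp]: "fps_qprod c h 0 = 1"
  by (simp add: fps_qprod_def)

lemma fps_qprod_1 [simp]: "fps_qprod c h (Suc 0) = h"
  by (simp add: fps_qprod_def)

lemma fps_qprod_Suc: "fps_qprod c h (Suc n) = fps_qprod c h n * fps_dilate (c ^ n) h"
  by (simp add: fps_qprod_def)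

lemma fps_qprod_add:
  "fps_qprod c h (m + n) = fps_qprod c h m * fps_dilate (c ^ m) (fps_qprod c h n)"
  by (induction n) (simp_all add: fps_qprod_Suc fps_dilate_mult fps_dilate_dilate power_add mult.assoc)

lemma fps_qprod_Suc': "fps_qprod c h (Suc n) = h * fps_dilate c (fps_qprod c h n)"
  using fps_qprod_add[of c h "Suc 0" n] by simp

lemma fps_qprod_nth_less:
  assumes "fps_nth h 0 = 0" "N < n"
  shows "fps_nth (fps_qprod c h n) N = 0"
  using assms(2)
proof (induction n arbitrary: N)
  case (Suc n)
  have "fps_nth (fps_qprod c h n) i * fps_nth (fps_dilate (c ^ n) h) (N - i) = 0" if "i \<le> N" for i
    using that Suc assms(1) by (cases "i < n") (auto simp: le_less)
  then show ?case unfolding fps_qprod_Suc fps_mult_nth by (intro sum.neutral ballI) (simp add: atLeast0AtMost)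
qed simp

text \<open>Each factor starts with a nonzero multiple of z. Together with
  \<open>fps_qprod_nth_less\<close> this makes the coefficient array triangular with nonzero
  diagonal.\<close>

lemma fps_qprod_nth_diag:
  assumes "fps_nth h 0 = 0" "fps_nth h 1 \<noteq> 0" "c \<noteq> 0"
  shows "fps_nth (fps_qprod c h n) n \<noteq> 0"
proof (induction n)
  case (Suc n)
  have "fps_nth (fps_qprod c h (Suc n)) (Suc n) =
      (\<Sum>i\<in>{0..Suc n}. fps_nth (fps_qprod c h n) i * (c ^ n) ^ (Suc n - i) * fps_nth h (Suc n - i))"
    by (simp add: fps_qprod_Suc fps_mult_nth mult.assoc)
  also have "\<dots> = (\<Sum>i\<in>{n}. fps_nth (fps_qprod c h n) i * (c ^ n) ^ (Suc n - i) * fps_nth h (Suc n - i))"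
    by (rule sum.mono_neutral_right)
      (auto simp: fps_qprod_nth_less[OF assms(1)] assms(1) not_less le_Suc_eq intro: le_less_trans dest: nat_less_le[THEN iffD2])
  finally show ?case using Suc assms by simp
qed simp

text \<open>Only products of at most N factors reach the coefficient of z^N, so the X-adic sum
  becomes finite with any cutoff \<open>M \<ge> N\<close>. The sum in \<open>is_q_inverse\<close>
  starts at f_1; the added term \<open>k = 0\<close> vanishes because f_0 = 0.\<close>

lemma is_q_inverse_nth:
  assumes "is_q_inverse q f g" "fps_nth f 0 = 0" "N \<le> M"
  shows "fps_nth (\<Sum>k\<le>M. fps_const (fps_nth f k) * fps_qprod (1 / q) g k) N = fps_nth fps_X N"
proof -
  define T where "T k = fps_const (fps_nth f k) * fps_qprod (1 / q) g k" for k
  have g0: "fps_nth g 0 = 0" using assms(1) by (simp add: is_q_inverse_def)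
  have "(\<Prod>i\<le>n. fps_dilate (1 / q ^ i) g) = fps_qprod (1 / q) g (Suc n)" for n
    by (simp add: fps_qprod_def power_one_over lessThan_Suc_atMost del: prod.lessThan_Suc)
  then have "(\<lambda>n. T (Suc n)) sums fps_X"
    using assms(1) by (simp add: is_q_inverse_def T_def)
  then have "\<forall>\<^sub>F m in sequentially. fps_nth (\<Sum>n<m. T (Suc n)) N = fps_nth fps_X N"
    by (simp add: sums_def tendsto_fps_iff del: fps_X_nth)
  then obtain m where m: "m \<ge> M" "fps_nth (\<Sum>n<m. T (Suc n)) N = fps_nth fps_X N"
    by (metis (mono_tags, lifting) eventually_sequentially linorder_linear)
  have "fps_nth (\<Sum>k\<le>m. T k) N = fps_nth (\<Sum>n<m. T (Suc n)) N"
    by (subst sum.atMost_shift) (simp add: T_def assms)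
  also have "fps_nth (\<Sum>k\<le>m. T k) N = fps_nth (\<Sum>k\<le>M. T k) N"
    unfolding fps_sum_nth
    by (rule sum.mono_neutral_right) (use m(1) assms(3) g0 in \<open>auto simp: T_def fps_qprod_nth_less\<close>)
  finally show ?thesis using m(2) by (simp add: T_def)
qed

lemma is_q_inverse_nth_1:
  assumes "is_q_inverse q f g" "fps_nth f 0 = 0" "fps_nth f 1 = 1"
  shows "fps_nth g 1 = 1"
  using is_q_inverse_nth[OF assms(1,2), of 1 1] assms(3) by simp

text \<open>The linear operator with \<open>z\<^sup>n \<mapsto> g(z) g(cz) \<dots> g(c\<^sup>n\<^sup>-\<^sup>1z)\<close>.\<close>

definition fps_qsubst :: "real \<Rightarrow> real fps \<Rightarrow> real fps \<Rightarrow> real fps" where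
  "fps_qsubst c g h = Abs_fps (\<lambda>N. \<Sum>n\<le>N. fps_nth h n * fps_nth (fps_qprod c g n) N)"

lemma fps_qsubst_nth:
  assumes "fps_nth g 0 = 0" "N \<le> M"
  shows "fps_nth (fps_qsubst c g h) N = (\<Sum>n\<le>M. fps_nth h n * fps_nth (fps_qprod c g n) N)"
  unfolding fps_qsubst_def fps_nth_Abs_fps
  by (rule sum.mono_neutral_left) (use assms in \<open>auto simp: fps_qprod_nth_less\<close>)

lemma fps_qsubst_X:
  assumes "fps_nth g 0 = 0"
  shows "fps_qsubst c g fps_X = g"
proof (rule fps_ext)
  fix N
  have "fps_nth (fps_qsubst c g fps_X) N =
      (\<Sum>n\<le>Suc N. fps_nth fps_X n * fps_nth (fps_qprod c g n) N)"
    by (rule fps_qsubst_nth) (use assms in auto)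
  also have "\<dots> = (\<Sum>n\<in>{1}. fps_nth fps_X n * fps_nth (fps_qprod c g n) N)"
    by (rule sum.mono_neutral_right) auto
  finally show "fps_nth (fps_qsubst c g fps_X) N = fps_nth g N" by simp
qed

text \<open>The operator is triangular with nonzero diagonal, so the coefficients of
  \<open>h\<close> are recovered from the image one at a time.\<close>

lemma fps_qsubst_inject:
  assumes "fps_nth g 0 = 0" "fps_nth g 1 \<noteq> 0" "c \<noteq> 0" "fps_qsubst c g h = fps_qsubst c g h'"
  shows "h = h'"
proof -
  have "fps_nth h N = fps_nth h' N" for N
  proof (induction N rule: less_induct)
    case (less N)
    have "(\<Sum>n\<le>N. fps_nth h n * fps_nth (fps_qprod c g n) N) =
        (\<Sum>n\<le>N. fps_nth h' n * fps_nth (fps_qprod c g n) N)"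
      using arg_cong[OF assms(4), of "\<lambda>h. fps_nth h N"] by (simp add: fps_qsubst_def)
    moreover have "(\<Sum>n<N. fps_nth h n * fps_nth (fps_qprod c g n) N) =
        (\<Sum>n<N. fps_nth h' n * fps_nth (fps_qprod c g n) N)"
      by (rule sum.cong) (use less in auto)
    ultimately show ?case
      using fps_qprod_nth_diag[OF assms(1-3), of N] by (simp flip: lessThan_Suc_atMost)
  qed
  then show ?thesis by (rule fps_ext)
qed

lemma fps_mult_nth_cong:
  fixes a b d :: "'a :: comm_ring_1 fps"
  assumes "\<And>k. k \<le> N \<Longrightarrow> fps_nth b k = fps_nth d k"
  shows "fps_nth (a * b) N = fps_nth (a * d) N"
  unfolding fps_mult_nth by (rule sum.cong) (use assms in auto)

text \<open>Here the equation defining \<open>g\<close> enters: the operator turns \<open>h(z) \<mapsto> f(z) h(qz)\<close> into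
  multiplication by \<open>z\<close>, which makes it the inverse of \<open>z\<^sup>n \<mapsto> f(z) f(qz) \<dots> f(q\<^sup>n\<^sup>-\<^sup>1z)\<close>.\<close>

lemma fps_qsubst_mult_dilate:
  assumes inv: "is_q_inverse q f g" and f0: "fps_nth f 0 = 0" and q: "q \<noteq> 0"
  shows "fps_qsubst (1 / q) g (f * fps_dilate q h) = fps_X * fps_qsubst (1 / q) g h"
proof (rule fps_ext)
  fix N
  let ?c = "1 / q"
  let ?G = "fps_qprod ?c g"
  have g0: "fps_nth g 0 = 0" using inv by (simp add: is_q_inverse_def)
  \<comment> \<open>Summing over m recreates the defining equation at the argument c^n z: G_(n+i)(z)
    = G_n(z) G_i(c^n z), and the sum of f_i G_i(c^n z) is c^n z. The factor c^n later cancels the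
    q^n that the dilation puts on the n-th coefficient of \<open>h\<close>.\<close>
  have inner: "(\<Sum>m\<in>{n..N}. fps_nth f (m - n) * fps_nth (?G m) N) = ?c ^ n * fps_nth (fps_X * ?G n) N"
    if "n \<le> N" for n
  proof -
    have "(\<Sum>m\<in>{n..N}. fps_nth f (m - n) * fps_nth (?G m) N) =
        (\<Sum>m\<in>{n..n+N}. fps_nth f (m - n) * fps_nth (?G m) N)"
      by (rule sum.mono_neutral_left) (use g0 in \<open>auto simp: fps_qprod_nth_less\<close>)
    also have "\<dots> = (\<Sum>i\<le>N. fps_nth f i * fps_nth (?G (n + i)) N)"
      by (rule sum.reindex_bij_witness[of _ "\<lambda>i. n + i" "\<lambda>m. m - n"]) auto
    also have "\<dots> = fps_nth (?G n * (\<Sum>i\<le>N. fps_const (fps_nth f i) * fps_dilate (?c ^ n) (?G i))) N"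
      by (simp add: fps_qprod_add sum_distrib_left fps_sum_nth mult.left_commute[of _ "fps_const _"])
    also have "\<dots> = fps_nth (?G n * (fps_const (?c ^ n) * fps_X)) N"
    proof (rule fps_mult_nth_cong)
      fix k assume k: "k \<le> N"
      have "fps_nth (\<Sum>i\<le>N. fps_const (fps_nth f i) * fps_dilate (?c ^ n) (?G i)) k =
          (?c ^ n) ^ k * fps_nth (\<Sum>i\<le>N. fps_const (fps_nth f i) * ?G i) k"
        by (simp add: fps_sum_nth sum_distrib_left mult_ac)
      also have "\<dots> = fps_nth (fps_const (?c ^ n) * fps_X) k"
        unfolding is_q_inverse_nth[OF inv f0 k] by (cases "k = 1") auto
      finally show "fps_nth (\<Sum>i\<le>N. fps_const (fps_nth f i) * fps_dilate (?c ^ n) (?G i)) k =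
        fps_nth (fps_const (?c ^ n) * fps_X) k" .
    qed
    also have "\<dots> = ?c ^ n * fps_nth (fps_X * ?G n) N"
      by (simp only: mult.left_commute[of "?G n"] mult.commute[of "?G n"] mult.assoc fps_mult_left_const_nth)
    finally show ?thesis .
  qed
  have f_nth: "fps_nth (f * fps_dilate q h) m = (\<Sum>n\<le>m. q ^ n * fps_nth h n * fps_nth f (m - n))" for m
    by (subst mult.commute) (simp add: fps_mult_nth atLeast0AtMost)
  have "fps_nth (fps_qsubst ?c g (f * fps_dilate q h)) N =
     (\<Sum>m\<le>N. \<Sum>n\<le>m. (q ^ n * fps_nth h n) * (fps_nth f (m - n) * fps_nth (?G m) N))"
    by (simp only: fps_qsubst_def fps_nth_Abs_fps f_nth sum_distrib_right mult.assoc)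
  also have "\<dots> = (\<Sum>n\<le>N. \<Sum>m\<in>{n..N}. (q ^ n * fps_nth h n) * (fps_nth f (m - n) * fps_nth (?G m) N))"
    by (simp add: sum.Sigma) (rule sum.reindex_bij_witness[of _ "\<lambda>(a,b). (b,a)" "\<lambda>(a,b). (b,a)"], auto)
  also have "\<dots> = (\<Sum>n\<le>N. fps_nth h n * fps_nth (fps_X * ?G n) N)"
    by (rule sum.cong) (use q in \<open>simp_all add: inner power_one_over flip: sum_distrib_left\<close>)
  also have "\<dots> = fps_nth (fps_X * fps_qsubst ?c g h) N"
  proof (cases N)
    case (Suc M)
    then show ?thesis
      by (simp add: fps_qsubst_nth[OF g0, of M "Suc M"] del: sum.atMost_Suc)
  qed simp
  finally show "fps_nth (fps_qsubst ?c g (f * fps_dilate q h)) N = fps_nth (fps_X * fps_qsubst ?c g h) N" .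
qed

text \<open>Splitting off the first factor gives F_(n+1)(z) = f(z) F_n(qz), so
  \<open>fps_qsubst_mult_dilate\<close> yields one factor z per step.\<close>

lemma fps_qsubst_qprod:
  assumes "is_q_inverse q f g" "fps_nth f 0 = 0" "q \<noteq> 0"
  shows "fps_qsubst (1 / q) g (fps_qprod q f n) = fps_X ^ n"
proof (induction n)
  case 0
  have "fps_nth (fps_qsubst (1 / q) g 1) N = fps_nth 1 N" for N
    by (simp add: fps_qsubst_def if_distrib[of "\<lambda>x. x * _"] cong: if_cong)
  then show ?case by (simp add: fps_ext)
next
  case (Suc n)
  show ?case unfolding fps_qprod_Suc' fps_qsubst_mult_dilate[OF assms] Suc by simp
qed

text \<open>The operator of \<open>g\<close> sends the n-th product of \<open>f\<close> to z^n,
  hence sends \<open>fps_qsubst q f g\<close> to \<open>g\<close>, which is also its value at z.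
  Injectivity then gives an equation that is linear in the coefficients of \<open>g\<close>.\<close>

theorem q_lagrange_duality:
  assumes inv: "is_q_inverse q f g" and f0: "fps_nth f 0 = 0" and f1: "fps_nth f 1 = 1" and q: "q \<noteq> 0"
  shows "fps_qsubst q f g = fps_X"
proof (rule fps_qsubst_inject)
  let ?G = "fps_qprod (1 / q) g"
  show g0: "fps_nth g 0 = 0" using inv by (simp add: is_q_inverse_def)
  show "fps_nth g 1 \<noteq> 0" using is_q_inverse_nth_1[OF inv f0 f1] by simp
  show "1 / q \<noteq> 0" using q by simp
  show "fps_qsubst (1 / q) g (fps_qsubst q f g) = fps_qsubst (1 / q) g fps_X"
  proof (rule fps_ext)
    fix N
    have "fps_nth (fps_qsubst (1 / q) g (fps_qsubst q f g)) N =
       (\<Sum>m\<le>N. \<Sum>n\<le>N. fps_nth g n * (fps_nth (fps_qprod q f n) m * fps_nth (?G m) N))"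
      unfolding fps_qsubst_nth[OF g0 order_refl]
      by (intro sum.cong refl, subst fps_qsubst_nth[OF f0, where M = N])
        (simp_all add: sum_distrib_left mult_ac)
    also have "\<dots> = (\<Sum>n\<le>N. fps_nth g n * fps_nth (fps_qsubst (1 / q) g (fps_qprod q f n)) N)"
      unfolding fps_qsubst_nth[OF g0 order_refl] sum_distrib_left by (rule sum.swap)
    also have "\<dots> = fps_nth g N"
      unfolding fps_qsubst_qprod[OF inv f0 q] by (simp add: if_distrib[of "(*) _"] cong: if_cong)
    finally show "fps_nth (fps_qsubst (1 / q) g (fps_qsubst q f g)) N = fps_nth (fps_qsubst (1 / q) g fps_X) N"
      by (simp add: fps_qsubst_X[OF g0])
  qed
qed

section \<open>The linear convolution identity\<close>

lemma choose_two_add: "(m + n) choose 2 = (m choose 2) + (n choose 2) + m * (n::nat)"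
  by (induction n) (simp_all add: numeral_2_eq_2)

lemma choose_two_Suc: "Suc n choose 2 = (n choose 2) + n"
  by (simp add: numeral_2_eq_2)

text \<open>The n factors X contribute q^0, q^1, ..., q^(n-1), whence the exponent n choose 2 in the
  normalization of \<open>g\<close>.\<close>

lemma fps_qprod_X_mult:
  "fps_qprod q (fps_X * h) n = fps_const (q ^ (n choose 2)) * (fps_X ^ n * fps_qprod q h n)"
proof (induction n)
  case (Suc n)
  have X: "fps_dilate (q ^ n) fps_X = fps_const (q ^ n) * fps_X"
  proof (rule fps_ext)
    fix k
    show "fps_nth (fps_dilate (q ^ n) fps_X) k = fps_nth (fps_const (q ^ n) * fps_X) k"
      by (cases "k = 1") auto
  qed
  show ?case
    by (simp add: fps_qprod_Suc Suc.IH fps_dilate_mult X choose_two_Suc power_add mult_ac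
        flip: fps_const_mult)
qed (simp add: numeral_2_eq_2)

lemma fps_qprod_mult_eigen:
  assumes "h * P = fps_dilate q P"
  shows "fps_qprod q h n * P = fps_dilate (q ^ n) P"
proof (induction n)
  case (Suc n)
  have "fps_qprod q h (Suc n) * P = fps_dilate q (fps_qprod q h n) * (h * P)"
    by (simp add: fps_qprod_Suc' mult_ac)
  also have "\<dots> = fps_dilate (q ^ Suc n) P"
    unfolding assms fps_dilate_mult[symmetric] Suc fps_dilate_dilate by simp
  finally show ?case .
qed simp

text \<open>With f(z) = z h(z), multiplying the dual equation by \<open>P\<close> telescopes every
  product: f(z) ... f(q^(n-1) z) P(z) = q^(n choose 2) z^n P(q^n z). Comparing coefficients of z^N
  gives the formula.\<close>

lemma q_inverse_convolution:
  assumes dual: "fps_qsubst q (fps_X * h) g = fps_X" and P: "h * P = fps_dilate q P"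
  shows "fps_nth (fps_X * P) N =
    (\<Sum>n\<le>N. q ^ (n choose 2) * fps_nth g n * q ^ (n * (N - n)) * fps_nth P (N - n))"
proof -
  let ?F = "fps_qprod q (fps_X * h)"
  have "fps_nth (fps_X * P) N = fps_nth (fps_qsubst q (fps_X * h) g * P) N"
    by (simp only: dual)
  also have "\<dots> = (\<Sum>k\<le>N. \<Sum>n\<le>N. fps_nth g n * (fps_nth (?F n) k * fps_nth P (N - k)))"
    unfolding fps_mult_nth atLeast0AtMost
    by (intro sum.cong refl, subst fps_qsubst_nth[where M = N])
      (simp_all add: sum_distrib_right mult.assoc)
  also have "\<dots> = (\<Sum>n\<le>N. fps_nth g n * fps_nth (?F n * P) N)"
    unfolding fps_mult_nth atLeast0AtMost sum_distrib_left by (rule sum.swap)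
  also have "\<dots> = (\<Sum>n\<le>N. q ^ (n choose 2) * fps_nth g n * q ^ (n * (N - n)) * fps_nth P (N - n))"
  proof (rule sum.cong[OF refl])
    fix n assume "n \<in> {..N}"
    have "?F n * P = fps_const (q ^ (n choose 2)) * (fps_X ^ n * fps_dilate (q ^ n) P)"
      by (simp add: fps_qprod_X_mult mult.assoc fps_qprod_mult_eigen[OF P])
    then show "fps_nth g n * fps_nth (?F n * P) N =
        q ^ (n choose 2) * fps_nth g n * q ^ (n * (N - n)) * fps_nth P (N - n)"
      using \<open>n \<in> {..N}\<close> by (simp add: fps_X_power_mult_nth power_mult)
  qed
  finally show ?thesis .
qed

text \<open>The recursion read off from (1 - p(z)) P(z) = P(qz) when p has no constant term: P_n
  occurs with factor 1 on the left and q^n on the right, which gives the divisor.\<close>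

fun q_eigen_coeff :: "real fps \<Rightarrow> real \<Rightarrow> nat \<Rightarrow> real" where
  "q_eigen_coeff p q n =
     (if n = 0 then 1 else (\<Sum>k<n. fps_nth p (n - k) * q_eigen_coeff p q k) / (1 - q ^ n))"

declare q_eigen_coeff.simps [simp del]

lemma fps_mult_nth_0_left:
  fixes p :: "'a :: comm_ring_1 fps"
  assumes "fps_nth p 0 = 0"
  shows "fps_nth (p * P) n = (\<Sum>k<n. fps_nth p (n - k) * fps_nth P k)"
proof -
  have "fps_nth (p * P) n = fps_nth (P * p) n" by (simp only: mult.commute)
  also have "\<dots> = (\<Sum>k<Suc n. fps_nth P k * fps_nth p (n - k))"
    by (simp only: fps_mult_nth atLeast0AtMost lessThan_Suc_atMost)
  finally show ?thesis using assms by (simp add: mult.commute)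
qed

lemma q_eigen_exists:
  fixes p :: "real fps"
  assumes "fps_nth p 0 = 0" "0 < q" "q < 1"
  obtains P where "fps_nth P 0 = 1" "(1 - p) * P = fps_dilate q P"
proof
  let ?P = "Abs_fps (q_eigen_coeff p q)"
  show "fps_nth ?P 0 = 1" by (simp add: q_eigen_coeff.simps)
  show "(1 - p) * ?P = fps_dilate q ?P"
  proof (rule fps_ext)
    fix n
    have "q ^ n \<noteq> 1" if "n > 0" using that assms power_less_one_iff[of q n] by auto
    moreover have "fps_nth (p * ?P) n = (\<Sum>k<n. fps_nth p (n - k) * q_eigen_coeff p q k)"
      by (simp add: fps_mult_nth_0_left[OF assms(1)])
    ultimately show "fps_nth ((1 - p) * ?P) n = fps_nth (fps_dilate q ?P) n"
      using assms(1) by (cases "n = 0") (auto simp: left_diff_distrib q_eigen_coeff.simps[of p q n] field_simps)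
  qed
qed

section \<open>Nonnegative polynomial dependence on q\<close>

text \<open>The series \<open>g q\<close> is given separately for each q, so polynomiality is
  phrased as a property of a function on the unit interval. The sign condition is stable under sums
  and products.\<close>

definition nonneg_poly_on_unit :: "(real \<Rightarrow> real) \<Rightarrow> bool" where
  "nonneg_poly_on_unit u \<longleftrightarrow>
    (\<exists>p. (\<forall>i. coeff p i \<ge> 0) \<and> represents_poly p u)"

lemma nonneg_poly_on_unit_cong:
  assumes "\<And>q. 0 < q \<Longrightarrow> q < 1 \<Longrightarrow> u q = v q" "nonneg_poly_on_unit v"
  shows "nonneg_poly_on_unit u"
  using assms by (simp add: nonneg_poly_on_unit_def represents_poly_def)

lemma nonneg_poly_on_unit_const: "c \<ge> 0 \<Longrightarrow> nonneg_poly_on_unit (\<lambda>_. c)"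
  unfolding nonneg_poly_on_unit_def represents_poly_def
  by (rule exI[of _ "[:c:]"]) (auto simp: coeff_pCons split: nat.split)

lemma nonneg_poly_on_unit_power: "nonneg_poly_on_unit (\<lambda>q. q ^ n)"
  unfolding nonneg_poly_on_unit_def represents_poly_def
  by (rule exI[of _ "monom 1 n"]) (auto simp: poly_monom)

lemma nonneg_poly_on_unit_add:
  assumes "nonneg_poly_on_unit u" "nonneg_poly_on_unit v"
  shows "nonneg_poly_on_unit (\<lambda>q. u q + v q)"
proof -
  from assms obtain p r where "\<forall>i. coeff p i \<ge> 0" "represents_poly p u"
      "\<forall>i. coeff r i \<ge> 0" "represents_poly r v"
    by (auto simp: nonneg_poly_on_unit_def)
  then show ?thesis unfolding nonneg_poly_on_unit_def represents_poly_def
    by (intro exI[of _ "p + r"]) auto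
qed

lemma nonneg_poly_on_unit_mult:
  assumes "nonneg_poly_on_unit u" "nonneg_poly_on_unit v"
  shows "nonneg_poly_on_unit (\<lambda>q. u q * v q)"
proof -
  from assms obtain p r where "\<forall>i. coeff p i \<ge> 0" "represents_poly p u"
      "\<forall>i. coeff r i \<ge> 0" "represents_poly r v"
    by (auto simp: nonneg_poly_on_unit_def)
  then show ?thesis unfolding nonneg_poly_on_unit_def represents_poly_def
    by (intro exI[of _ "p * r"]) (auto simp: coeff_mult intro!: sum_nonneg)
qed

lemma nonneg_poly_on_unit_sum:
  assumes "\<And>i. i \<in> I \<Longrightarrow> nonneg_poly_on_unit (u i)"
  shows "nonneg_poly_on_unit (\<lambda>q. \<Sum>i\<in>I. u i q)"
proof (cases "finite I")
  case True
  then show ?thesis using assms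
    by (induction I) (auto intro: nonneg_poly_on_unit_const nonneg_poly_on_unit_add)
qed (auto intro: nonneg_poly_on_unit_const)

text \<open>Multiplying the coefficients of \<open>g(z) g(z/q) \<dots>\<close> by \<open>q\<^bsup>n choose 2\<^esup>\<close> makes all powers of
  \<open>q\<close> in this recursion nonnegative.\<close>

lemma q_weighted_qprod_Suc:
  fixes g :: "real fps"
  assumes "fps_nth g 0 = 0" "q \<noteq> 0"
  shows "q ^ (n choose 2) * fps_nth (fps_qprod (1 / q) g (Suc k)) n =
    (\<Sum>m\<in>{1..n}. (q ^ (m choose 2) * fps_nth g m) *
      ((q ^ ((n - m) choose 2) * fps_nth (fps_qprod (1 / q) g k) (n - m)) * q ^ ((m - 1) * (n - m))))"
proof -
  have "q ^ (n choose 2) * fps_nth (fps_qprod (1 / q) g (Suc k)) n =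
     (\<Sum>m\<le>n. q ^ (n choose 2) * (fps_nth g m * ((1 / q) ^ (n - m) * fps_nth (fps_qprod (1 / q) g k) (n - m))))"
    by (simp add: fps_qprod_Suc' fps_mult_nth atLeast0AtMost sum_distrib_left)
  also have "\<dots> = (\<Sum>m\<in>{1..n}. q ^ (n choose 2) * (fps_nth g m * ((1 / q) ^ (n - m) * fps_nth (fps_qprod (1 / q) g k) (n - m))))"
    by (rule sum.mono_neutral_right) (use assms in \<open>auto simp: not_le\<close>)
  also have "\<dots> = (\<Sum>m\<in>{1..n}. (q ^ (m choose 2) * fps_nth g m) *
      ((q ^ ((n - m) choose 2) * fps_nth (fps_qprod (1 / q) g k) (n - m)) * q ^ ((m - 1) * (n - m))))"
  proof (rule sum.cong[OF refl])
    fix m assume "m \<in> {1..n}"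
    \<comment> \<open>With m = a + 1 and n = m + b the exponent is (n choose 2) - b = (m choose 2) +
      (b choose 2) + a b, because m b - b = a b.\<close>
    then obtain a b where m: "m = Suc a" "n = Suc a + b"
      by (metis atLeastAtMost_iff le_iff_add not0_implies_Suc not_one_le_zero)
    show "q ^ (n choose 2) * (fps_nth g m * ((1 / q) ^ (n - m) * fps_nth (fps_qprod (1 / q) g k) (n - m))) =
      (q ^ (m choose 2) * fps_nth g m) *
      ((q ^ ((n - m) choose 2) * fps_nth (fps_qprod (1 / q) g k) (n - m)) * q ^ ((m - 1) * (n - m)))"
      unfolding m choose_two_add using assms by (simp add: power_add power_one_over)
  qed
  finally show ?thesis .
qed

text \<open>Solving the defining equation for g_n leaves products of at least two factors, with
  nonnegative weights. Such products involve only g_m with m < n, so strong induction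
  applies.\<close>

theorem nonneg_poly_q_inverse:
  assumes phi0: "fps_nth \<phi> 0 = 0" and nonneg: "\<And>i. fps_nth \<phi> i \<ge> 0"
    and inv: "\<And>q. 0 < q \<Longrightarrow> q < 1 \<Longrightarrow> is_q_inverse q (fps_X * (1 - \<phi>)) (g q)"
  shows "nonneg_poly_on_unit (\<lambda>q. q ^ (n choose 2) * fps_nth (g q) n)"
proof (induction n rule: less_induct)
  case (less n)
  let ?b = "\<lambda>n q. q ^ (n choose 2) * fps_nth (g q) n"
  let ?B = "\<lambda>k n q. q ^ (n choose 2) * fps_nth (fps_qprod (1 / q) (g q) k) n"
  have g0: "fps_nth (g q) 0 = 0" if "0 < q" "q < 1" for q
    using inv[OF that] by (simp add: is_q_inverse_def)
  have f0: "fps_nth (fps_X * (1 - \<phi>)) 0 = 0" by simp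
  have step: "nonneg_poly_on_unit (?B (Suc k) m)"
    if "\<And>i. i \<in> {1..m} \<Longrightarrow> nonneg_poly_on_unit (\<lambda>q. ?b i q * ?B k (m - i) q)" for k m
  proof -
    have eq: "?B (Suc k) m q = (\<Sum>i\<in>{1..m}. (?b i q * ?B k (m - i) q) * q ^ ((i - 1) * (m - i)))"
      if "0 < q" "q < 1" for q
      using q_weighted_qprod_Suc[OF g0[OF that], where n = m and k = k] that by (simp only: mult.assoc)
    show ?thesis
      by (rule nonneg_poly_on_unit_cong[OF eq], assumption+)
        (intro nonneg_poly_on_unit_sum nonneg_poly_on_unit_mult[OF that nonneg_poly_on_unit_power])
  qed
  have B: "nonneg_poly_on_unit (?B k m)" if "m < n" for k m
    using that
  proof (induction k arbitrary: m)
    case 0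
    then show ?case
      by (cases "m = 0") (auto simp: numeral_2_eq_2 intro!: nonneg_poly_on_unit_const)
  next
    case (Suc k)
    show ?case
      by (rule step, rule nonneg_poly_on_unit_mult[OF less.IH Suc.IH]) (use Suc.prems in auto)
  qed
  \<comment> \<open>At \<open>i = n\<close> the factor g_n would appear, but it multiplies the
    constant coefficient of a nonempty product, which is zero.\<close>
  have B2: "nonneg_poly_on_unit (?B (Suc (Suc k)) n)" for k
  proof (rule step)
    fix i assume i: "i \<in> {1..n}"
    show "nonneg_poly_on_unit (\<lambda>q. ?b i q * ?B (Suc k) (n - i) q)"
    proof (cases "i = n")
      case True
      then show ?thesis
        by (intro nonneg_poly_on_unit_cong[OF _ nonneg_poly_on_unit_const[of 0]])
          (auto simp: g0 fps_qprod_nth_less)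
    next
      case False
      with i show ?thesis by (intro nonneg_poly_on_unit_mult[OF less.IH B]) auto
    qed
  qed
  \<comment> \<open>Here f_1 = 1 and f_(k+2) = -\<phi>_(k+1), so moving all terms but the first to
    the other side makes the weights nonnegative.\<close>
  have eq: "?b n q = q ^ (n choose 2) * fps_nth fps_X n + (\<Sum>k<n. fps_nth \<phi> (Suc k) * ?B (Suc (Suc k)) n q)"
    if q: "0 < q" "q < 1" for q
  proof -
    have "(\<Sum>k\<le>Suc n. fps_nth (fps_X * (1 - \<phi>)) k * fps_nth (fps_qprod (1 / q) (g q) k) n) = fps_nth fps_X n"
      using is_q_inverse_nth[OF inv[OF q] f0, of n "Suc n"] by (simp add: fps_sum_nth del: sum.atMost_Suc fps_X_nth)
    then have "fps_nth (g q) n = fps_nth fps_X n + (\<Sum>k<n. fps_nth \<phi> (Suc k) * fps_nth (fps_qprod (1 / q) (g q) (Suc (Suc k))) n)"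
      unfolding sum.atMost_shift[of _ "Suc n"] sum.lessThan_Suc_shift
      using phi0 by (auto simp: sum_negf split: if_splits)
    then show ?thesis
      by (simp add: distrib_left sum_distrib_left mult.left_commute del: fps_X_nth)
  qed
  show ?case
    by (rule nonneg_poly_on_unit_cong[OF eq], assumption+, intro nonneg_poly_on_unit_add
        nonneg_poly_on_unit_sum nonneg_poly_on_unit_mult[OF nonneg_poly_on_unit_power nonneg_poly_on_unit_const]
        nonneg_poly_on_unit_mult[OF nonneg_poly_on_unit_const B2])
      (simp_all add: nonneg)
qed

section \<open>Regularly varying sequences\<close>

lemma regularly_varying_tendsto:
  assumes "regularly_varying u \<alpha>" "s > 0" "filterlim t at_top F"
  shows "((\<lambda>x. u (nat \<lfloor>s * t x\<rfloor>) / u (nat \<lfloor>t x\<rfloor>)) \<longlongrightarrow> s powr \<alpha>) F"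
  using filterlim_compose[OF _ assms(3)] assms(1,2) unfolding regularly_varying_def by blast

lemma regularly_varying_tendsto_nat:
  assumes "regularly_varying u \<alpha>" "s > 0"
  shows "(\<lambda>n. u (nat \<lfloor>s * real n\<rfloor>) / u n) \<longlonglongrightarrow> s powr \<alpha>"
  using regularly_varying_tendsto[OF assms filterlim_real_sequentially] by simp

text \<open>At s = 1 the quotient is u_n / u_n, which is 0 at a zero of u by the convention for
  division; the limit 1 excludes zeros for all large n.\<close>

lemma regularly_varying_eventually_pos:
  assumes "regularly_varying u \<alpha>" "\<And>n. u n \<ge> 0"
  shows "\<forall>\<^sub>F n in sequentially. u n > 0"
proof -
  have "(\<lambda>n. u n / u n) \<longlonglongrightarrow> 1"
    using regularly_varying_tendsto_nat[OF assms(1), of 1] by simp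
  then have "\<forall>\<^sub>F n in sequentially. u n / u n > 0"
    by (rule order_tendstoD) simp
  then show ?thesis
    by (rule eventually_mono) (use assms(2) in \<open>auto simp: less_le\<close>)
qed

text \<open>For irrational \<open>s\<close> no \<open>p/s\<close> is an integer, so just below and at \<open>t = p/s\<close> the number
  \<open>\<lfloor>t\<rfloor>\<close> is the same while \<open>\<lfloor>st\<rfloor>\<close> jumps from \<open>p - 1\<close> to \<open>p\<close>.\<close>

lemma regularly_varying_Suc_ratio:
  assumes rv: "regularly_varying u \<alpha>"
  shows "(\<lambda>n. u (Suc n) / u n) \<longlonglongrightarrow> 1"
proof -
  obtain s :: real where s: "1 < s" "s \<notin> \<rat>"
    using uncountable_minus_countable[OF uncountable_open_interval[THEN iffD2, of 1 2] countable_rat]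
    by (metis DiffD1 DiffD2 countable_empty equals0I greaterThanLessThan_iff one_less_numeral_iff semiring_norm(76))
  define t1 where "t1 n = real (Suc n) / s" for n
  define k where "k n = \<lfloor>t1 n\<rfloor>" for n
  \<comment> \<open>The point (n + 1/2) / s lies below \<open>t1 n\<close>, and s times it is at
    least n; the maximum with k keeps the floor at k. That k itself lies strictly below
    \<open>t1 n\<close> is where irrationality enters.\<close>
  define t0 where "t0 n = max (real_of_int (k n)) ((real n + 1 / 2) / s)" for n
  have k1: "real_of_int (k n) < t1 n" for n
  proof -
    have "real_of_int (k n) \<noteq> t1 n"
    proof
      assume eq: "real_of_int (k n) = t1 n"
      then have "real_of_int (k n) \<noteq> 0" using s by (simp add: t1_def)
      then have "s = real (Suc n) / real_of_int (k n)" using s unfolding eq t1_def by simp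
      then show False using s(2) by simp
    qed
    then show ?thesis unfolding k_def by linarith
  qed
  have k0: "\<lfloor>t0 n\<rfloor> = k n" for n
  proof (rule floor_unique)
    have "(real n + 1 / 2) / s \<le> t1 n"
      unfolding t1_def using s by (intro divide_right_mono) auto
    then show "t0 n < real_of_int (k n) + 1"
      unfolding t0_def k_def by linarith
  qed (simp add: t0_def)
  have f1: "nat \<lfloor>s * t1 n\<rfloor> = Suc n" for n
  proof -
    have "s * t1 n = real_of_int (int (Suc n))" using s by (simp add: t1_def)
    then show ?thesis by (simp only: floor_of_int nat_int)
  qed
  have f0: "\<lfloor>s * t0 n\<rfloor> = int n" for n
  proof (rule floor_unique)
    have "real n + 1 / 2 \<le> s * t0 n"
      using s by (simp add: t0_def max_def field_simps)
    then show "real_of_int (int n) \<le> s * t0 n" by simp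
    have "t0 n < t1 n"
      unfolding t0_def using k1[of n] s by (auto simp: t1_def intro: divide_strict_right_mono)
    then show "s * t0 n < real_of_int (int n) + 1"
      using s by (simp add: t1_def field_simps)
  qed
  have lim: "filterlim (\<lambda>n. 1 / s * real n) at_top sequentially"
    using s by (intro filterlim_tendsto_pos_mult_at_top[OF tendsto_const] filterlim_real_sequentially) auto
  have lim0: "filterlim t0 at_top sequentially"
  proof (rule filterlim_at_top_mono[OF lim], rule always_eventually, rule allI)
    fix n
    have "1 / s * real n \<le> (real n + 1 / 2) / s" using s by (simp add: field_simps)
    then show "1 / s * real n \<le> t0 n" by (simp add: t0_def)
  qed
  have lim1: "filterlim t1 at_top sequentially"
    by (rule filterlim_at_top_mono[OF lim], rule always_eventually)
      (use s in \<open>auto simp: t1_def field_simps\<close>)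
  have T0: "(\<lambda>n. u n / u (nat (k n))) \<longlonglongrightarrow> s powr \<alpha>"
    using regularly_varying_tendsto[OF rv _ lim0, of s] s by (simp add: k0 f0)
  have T1: "(\<lambda>n. u (Suc n) / u (nat (k n))) \<longlonglongrightarrow> s powr \<alpha>"
    using regularly_varying_tendsto[OF rv _ lim1, of s] s by (simp add: f1 flip: k_def)
  have "(\<lambda>n. (u (Suc n) / u (nat (k n))) / (u n / u (nat (k n)))) \<longlonglongrightarrow> s powr \<alpha> / s powr \<alpha>"
    by (intro tendsto_divide T0 T1) (use s in auto)
  moreover have "\<forall>\<^sub>F n in sequentially. u n / u (nat (k n)) > 0"
    by (rule order_tendstoD[OF T0]) (use s in auto)
  then have "\<forall>\<^sub>F n in sequentially. (u (Suc n) / u (nat (k n))) / (u n / u (nat (k n))) = u (Suc n) / u n"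
    by (rule eventually_mono) (auto simp: field_simps)
  ultimately have "(\<lambda>n. u (Suc n) / u n) \<longlonglongrightarrow> s powr \<alpha> / s powr \<alpha>"
    by (rule Lim_transform_eventually)
  then show ?thesis using s by simp
qed

section \<open>Uniform comparison of nearby terms and Potter bounds\<close>

text \<open>If no closure contained a subinterval, the relatively open complements would all be
  dense, hence so would their intersection; but that is empty because the sets cover.\<close>

lemma Baire_interval:
  fixes E :: "nat \<Rightarrow> real set"
  assumes "a < b" "{a..b} \<subseteq> (\<Union>N. E N)"
  obtains N c d where "a \<le> c" "c < d" "d \<le> b" "{c..d} \<subseteq> closure (E N)"
proof -
  let ?G = "range (\<lambda>N. {a..b} - closure (E N))"
  have empty: "\<Inter>?G = {}"
  proof (rule equals0I)
    fix x assume x: "x \<in> \<Inter>?G"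
    then obtain N where "x \<in> E N" using assms(2) by blast
    then have "x \<in> closure (E N)" using closure_subset by blast
    with x show False by blast
  qed
  have "\<not> {a..b} \<subseteq> closure (\<Inter>?G)"
    unfolding empty using assms(1) by simp
  moreover have "openin (top_of_set {a..b}) ({a..b} - closure (E N))" for N
    by (simp add: Diff_eq openin_open_Int open_Compl)
  ultimately obtain N where "\<not> {a..b} \<subseteq> closure ({a..b} - closure (E N))"
    using Baire[of "{a..b}" ?G] by auto
  then obtain x where x: "x \<in> {a..b}" "x \<in> - closure ({a..b} - closure (E N))"
    by blast
  then obtain e where e: "e > 0" "ball x e \<subseteq> - closure ({a..b} - closure (E N))"
    using openE[OF open_Compl[OF closed_closure]] by metis
  define c where "c = max a (x - e / 2)"
  define d where "d = min b (x + e / 2)"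
  have "{c..d} \<subseteq> ball x e \<inter> {a..b}"
    using e(1) by (auto simp: c_def d_def dist_real_def)
  then have "{c..d} \<subseteq> closure (E N)"
    using e(2) closure_subset[of "{a..b} - closure (E N)"] by blast
  moreover have "a \<le> c" "c < d" "d \<le> b" using x(1) e(1) assms(1) by (auto simp: c_def d_def)
  ultimately show ?thesis using that by blast
qed

text \<open>Equality up to a factor K in both directions, written without quotients so that zeros
  cause no trouble.\<close>

definition comparable :: "real \<Rightarrow> real \<Rightarrow> real \<Rightarrow> bool" where
  "comparable K x y \<longleftrightarrow> x \<le> K * y \<and> y \<le> K * x"

lemma comparable_sym: "comparable K x y \<Longrightarrow> comparable K y x"
  by (auto simp: comparable_def)

lemma comparable_trans:
  assumes "comparable K x y" "comparable L y z" "K \<ge> 0" "L \<ge> 0"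
  shows "comparable (K * L) x z"
proof -
  have "K * y \<le> K * (L * z)" "L * y \<le> L * (K * x)"
    using assms by (auto simp: comparable_def intro: mult_left_mono)
  then show ?thesis using assms by (auto simp: comparable_def mult_ac)
qed

lemma eventually_comparable:
  assumes "(\<lambda>n. v n / u n) \<longlonglongrightarrow> l" "l > 0" "l < K" "1 / l < K"
    and "\<forall>\<^sub>F n in sequentially. u n > (0::real)"
  shows "\<forall>\<^sub>F n in sequentially. comparable K (v n) (u n)"
proof -
  have K: "K > 0" using assms(2,3) by simp
  have "1 / K < l" using assms K by (simp add: field_simps)
  then have "\<forall>\<^sub>F n in sequentially. v n / u n > 1 / K" by (rule order_tendstoD[OF assms(1)])
  moreover have "\<forall>\<^sub>F n in sequentially. v n / u n < K" by (rule order_tendstoD(2)[OF assms(1,3)])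
  ultimately show ?thesis using assms(5)
    by eventually_elim (use K in \<open>auto simp: comparable_def field_simps\<close>)
qed

text \<open>The limit holds separately for each s. The sets of s whose bound is valid from N on
  cover [1, 2], so by Baire one of them is dense in some [c, d]. Moving s by less than 1/n shifts
  the floor by at most one, which u_(n+1) / u_n -> 1 absorbs, so density suffices.\<close>

lemma regularly_varying_comparable_interval:
  assumes rv: "regularly_varying u \<alpha>" and u: "\<And>n. u n \<ge> 0"
  obtains K N c d where "K \<ge> 1" "1 \<le> c" "c < d"
    "\<And>n s. n \<ge> N \<Longrightarrow> c \<le> s \<Longrightarrow> s \<le> d \<Longrightarrow> comparable K (u (nat \<lfloor>s * real n\<rfloor>)) (u n)"
proof -
  \<comment> \<open>Exceeds s^\<alpha> and s^(-\<alpha>) for all s in [1, 2] at once.\<close>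
  define K where "K = 1 + 2 powr \<bar>\<alpha>\<bar>"
  define E where "E N = {s\<in>{1..2}. \<forall>n\<ge>N. comparable K (u (nat \<lfloor>s * real n\<rfloor>)) (u n)}" for N
  have pos: "\<forall>\<^sub>F n in sequentially. u n > 0"
    using regularly_varying_eventually_pos[OF rv u] .
  have cover: "{1..2} \<subseteq> (\<Union>N. E N)"
  proof
    fix s :: real assume s: "s \<in> {1..2}"
    have b: "s powr b < K" if "\<bar>b\<bar> = \<bar>\<alpha>\<bar>" for b
    proof -
      have "s powr b \<le> s powr \<bar>\<alpha>\<bar>" using s that by (intro powr_mono) auto
      also have "\<dots> \<le> 2 powr \<bar>\<alpha>\<bar>" using s by (intro powr_mono2) auto
      finally show ?thesis by (simp add: K_def)
    qed
    have "\<forall>\<^sub>F n in sequentially. comparable K (u (nat \<lfloor>s * real n\<rfloor>)) (u n)"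
      using s b[of \<alpha>] b[of "-\<alpha>"]
      by (intro eventually_comparable[OF regularly_varying_tendsto_nat[OF rv] _ _ _ pos])
        (auto simp: powr_minus_divide)
    then show "s \<in> (\<Union>N. E N)"
      using s by (auto simp: E_def eventually_sequentially)
  qed
  have "(1::real) < 2" by simp
  then obtain N c d where cd: "1 \<le> c" "c < d" "d \<le> 2" "{c..d} \<subseteq> closure (E N)"
    by (rule Baire_interval[OF _ cover])
  have "\<forall>\<^sub>F n in sequentially. comparable 2 (u (Suc n)) (u n)"
    by (rule eventually_comparable[OF regularly_varying_Suc_ratio[OF rv] _ _ _ pos]) auto
  then obtain M where M: "\<And>n. n \<ge> M \<Longrightarrow> comparable 2 (u (Suc n)) (u n)"
    by (auto simp: eventually_sequentially)
  have K: "K \<ge> 1" by (simp add: K_def)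
  have "comparable (2 * K) (u (nat \<lfloor>s * real n\<rfloor>)) (u n)"
    if n: "n \<ge> N + M + 1" and s: "c \<le> s" "s \<le> d" for n s
  proof -
    have "s \<in> closure (E N)" "1 / real n > 0" using cd(4) s n by auto
    then obtain s' where s': "s' \<in> E N" "dist s' s < 1 / real n"
      by (meson closure_approachable)
    have c': "comparable K (u (nat \<lfloor>s' * real n\<rfloor>)) (u n)" and s1: "s' \<ge> 1"
      using s'(1) n by (auto simp: E_def)
    have "\<bar>s' - s\<bar> * real n < 1"
      using s'(2) n by (simp add: dist_real_def field_simps)
    then have "\<bar>s' * real n - s * real n\<bar> < 1"
      by (simp add: abs_mult flip: left_diff_distrib)
    then have "\<bar>\<lfloor>s' * real n\<rfloor> - \<lfloor>s * real n\<rfloor>\<bar> \<le> 1" by linarith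
    moreover have "real n \<le> s' * real n" "real n \<le> s * real n"
      using s1 s cd(1) mult_right_mono[of 1 s' "real n"] mult_right_mono[of 1 s "real n"] by auto
    then have "int n \<le> \<lfloor>s' * real n\<rfloor>" "int n \<le> \<lfloor>s * real n\<rfloor>" by linarith+
    moreover define i where "i = nat \<lfloor>s * real n\<rfloor>"
    moreover define j where "j = nat \<lfloor>s' * real n\<rfloor>"
    ultimately have "i = j \<or> i = Suc j \<or> j = Suc i" "i \<ge> M" "j \<ge> M" using n by linarith+
    then have "comparable 2 (u i) (u j)"
      using M[of i] M[of j] u by (auto simp: comparable_def mult.commute[of 2] intro: comparable_sym)
    then show ?thesis using c'
      unfolding i_def j_def by (rule comparable_trans) (use K in auto)
  qed
  then show ?thesis
    by (rule that[of "2 * K" c d, rotated 3]) (use cd K in auto)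
qed

text \<open>If m / n is at most some \<mu> < d / c, both n and m lie in [c k, d k] for k near n / c
  and are compared through u_k. Iterating with a ratio \<nu> > 1 passes 2 after finitely many
  steps.\<close>

lemma regularly_varying_comparable_double:
  assumes rv: "regularly_varying u \<alpha>" and u: "\<And>n. u n \<ge> 0"
  obtains K N where "K \<ge> 1"
    "\<And>n m. n \<ge> N \<Longrightarrow> n \<le> m \<Longrightarrow> m \<le> 2 * n \<Longrightarrow> comparable K (u m) (u n)"
proof -
  obtain K N c d where K: "K \<ge> 1" and cd: "1 \<le> c" "c < d"
    and cmp: "\<And>n s. n \<ge> N \<Longrightarrow> c \<le> s \<Longrightarrow> s \<le> d \<Longrightarrow> comparable K (u (nat \<lfloor>s * real n\<rfloor>)) (u n)"
    using regularly_varying_comparable_interval[OF rv u] by metis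
  define r where "r = d / c"
  define \<mu> where "\<mu> = (1 + r) / 2"
  have "r > 1" using cd by (simp add: r_def field_simps)
  then have \<mu>: "\<mu> > 1" "\<mu> < r" by (simp_all add: \<mu>_def)
  \<comment> \<open>The first bound gives \<open>k \<ge> N\<close>; the second makes the surplus (r
    - \<mu>) n at least d, the most that rounding k can cost.\<close>
  obtain N1 :: nat where N1: "real N1 \<ge> c * (real N + 2)" "real N1 \<ge> d / (r - \<mu>)"
    by (metis max.bounded_iff real_arch_simple)
  have base: "comparable (K * K) (u m) (u n)"
    if n: "n \<ge> N1" and m: "n \<le> m" "real m \<le> \<mu> * real n" for n m
  proof -
    define k where "k = nat \<lfloor>real n / c\<rfloor>"
    have "real n \<ge> c * (real N + 2)" using n N1(1) by linarith
    then have nc: "real n / c \<ge> real N + 2" using cd by (simp add: field_simps)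
    then have k: "real k \<le> real n / c" "real n / c < real k + 1" "k \<ge> N" "k > 0"
      unfolding k_def by linarith+
    have "real n \<ge> d / (r - \<mu>)" using n N1(2) by linarith
    then have "d * (real n / c) - \<mu> * real n \<ge> d"
      using \<mu> by (simp add: pos_divide_le_eq algebra_simps) (simp add: r_def)
    moreover have "d * (real n / c) \<le> d * (real k + 1)" using k(2) cd by (intro mult_left_mono) auto
    ultimately have "\<mu> * real n \<le> d * real k" by (simp add: algebra_simps)
    then have dk: "real m \<le> d * real k" "c * real k \<le> real n"
      using m k(1) cd by (auto simp: field_simps)
    have "comparable K (u l) (u k)" if "n \<le> l" "l \<le> m" for l
    proof -
      have "real n \<le> real l" "real l \<le> real m" using that by auto
      then have "c * real k \<le> real l" "real l \<le> d * real k" using dk by linarith+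
      then have "comparable K (u (nat \<lfloor>real l / real k * real k\<rfloor>)) (u k)"
        by (intro cmp k(3)) (use k(4) in \<open>auto simp: field_simps\<close>)
      then show ?thesis using k(4) by simp
    qed
    from this[of m] this[of n] m show ?thesis
      by (intro comparable_trans[where y = "u k"] comparable_sym[of K "u n"]) (use K in auto)
  qed
  \<comment> \<open>Smaller than \<mu>, so that the intermediate index p, the ceiling of m / \<mu>,
    still satisfies p \<le> \<nu>^j n for large n.\<close>
  define \<nu> where "\<nu> = (1 + \<mu>) / 2"
  have \<nu>: "\<nu> > 1" "\<nu> < \<mu>" using \<mu> by (auto simp: \<nu>_def)
  have KK: "K * K \<ge> 1" using K mult_mono[of 1 K 1 K] by simp
  have iter: "\<exists>L M. L \<ge> 1 \<and> (\<forall>n\<ge>M. \<forall>m. n \<le> m \<longrightarrow> real m \<le> \<nu> ^ j * real n \<longrightarrow> comparable L (u m) (u n))" for j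
  proof (induction j)
    case 0
    have "comparable 1 (u m) (u n)" if "n \<le> m" "real m \<le> real n" for m n
      using that by (auto simp: comparable_def)
    then show ?case by (intro exI[of _ 1]) auto
  next
    case (Suc j)
    then obtain L M where L: "L \<ge> 1"
      and LM: "\<And>n m. n \<ge> M \<Longrightarrow> n \<le> m \<Longrightarrow> real m \<le> \<nu> ^ j * real n \<Longrightarrow> comparable L (u m) (u n)"
      by blast
    obtain N2 :: nat where N2: "real N2 \<ge> 1 / (1 - \<nu> / \<mu>)" using real_arch_simple by blast
    have "comparable (K * K * L) (u m) (u n)"
      if n: "n \<ge> M + N1 + N2 + 1" and m: "n \<le> m" "real m \<le> \<nu> ^ Suc j * real n" for n m
    proof (cases "real m \<le> \<mu> * real n")
      case True
      then have "comparable (K * K) (u m) (u n)" by (intro base) (use n m in auto)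
      moreover have "comparable L (u n) (u n)"
        using L u[of n] mult_right_mono[of 1 L "u n"] by (simp add: comparable_def)
      ultimately show ?thesis by (rule comparable_trans) (use KK L in auto)
    next
      case False
      define p where "p = nat \<lceil>real m / \<mu>\<rceil>"
      have "real m / \<mu> \<le> real m" using \<mu> mult_right_mono[of 1 \<mu> "real m"] by (simp add: field_simps)
      moreover have "real n < real m / \<mu>" using False \<mu> by (simp add: field_simps)
      ultimately have p: "n \<le> p" "p \<le> m" "real m / \<mu> \<le> real p" "real p \<le> real m / \<mu> + 1"
        unfolding p_def by linarith+
      have "real n \<ge> 1 / (1 - \<nu> / \<mu>)" using n N2 by linarith
      then have n1: "(1 - \<nu> / \<mu>) * real n \<ge> 1" using \<nu> by (simp add: field_simps)
      have "1 * ((1 - \<nu> / \<mu>) * real n) \<le> \<nu> ^ j * ((1 - \<nu> / \<mu>) * real n)"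
        using n1 \<nu> by (intro mult_right_mono one_le_power) auto
      with n1 have n2: "1 \<le> \<nu> ^ j * real n - \<nu> ^ Suc j * real n / \<mu>"
        by (simp add: algebra_simps)
      have "real m / \<mu> \<le> \<nu> ^ Suc j * real n / \<mu>" using m(2) \<mu> by (intro divide_right_mono) auto
      with p(4) n2 have "real p \<le> \<nu> ^ j * real n" by linarith
      then have pn: "comparable L (u p) (u n)" by (intro LM) (use n p in auto)
      have "comparable (K * K) (u m) (u p)"
        by (rule base) (use n p \<mu> in \<open>auto simp: pos_divide_le_eq mult.commute\<close>)
      from this pn show ?thesis by (rule comparable_trans) (use KK L in auto)
    qed
    moreover have "K * K * L \<ge> 1" using KK L mult_mono[of 1 "K * K" 1 L] by simp
    ultimately show ?case by blast
  qed
  obtain j where j: "\<nu> ^ j > 2" using real_arch_pow[OF \<nu>(1)] by blast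
  obtain L M where L: "L \<ge> 1"
      and LM: "\<And>n m. n \<ge> M \<Longrightarrow> n \<le> m \<Longrightarrow> real m \<le> \<nu> ^ j * real n \<Longrightarrow> comparable L (u m) (u n)"
    using iter[of j] by blast
  show ?thesis
  proof (rule that[OF L])
    fix n m assume *: "n \<ge> M" "n \<le> m" "m \<le> 2 * n"
    have "2 * real n \<le> \<nu> ^ j * real n" using j by (intro mult_right_mono) auto
    then show "comparable L (u m) (u n)" using * by (intro LM) auto
  qed
qed

text \<open>Doubling the index multiplies u by nearly 2^\<alpha>, strictly between 2^(-b) and 2.
  Chains of doublings give the power bounds; K is paid only once, for the last incomplete
  doubling.\<close>

lemma regularly_varying_Potter:
  assumes rv: "regularly_varying u \<alpha>" and u: "\<And>n. u n \<ge> 0"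
    and a: "\<alpha> < 1" and b: "-\<alpha> < b" "0 < b"
  obtains K N where "K \<ge> 1" "N \<ge> 1" "\<And>n. n \<ge> N \<Longrightarrow> u n > 0"
    "\<And>n k. n \<ge> N \<Longrightarrow> n \<le> k \<Longrightarrow> u k \<le> K * (real k / real n) * u n"
    "\<And>n k. k \<ge> N \<Longrightarrow> k \<le> n \<Longrightarrow> u k \<le> K * (real n / real k) powr b * u n"
proof -
  obtain K N0 where K: "K \<ge> 1"
    and N0: "\<And>n m. n \<ge> N0 \<Longrightarrow> n \<le> m \<Longrightarrow> m \<le> 2 * n \<Longrightarrow> comparable K (u m) (u n)"
    using regularly_varying_comparable_double[OF rv u] by metis
  have pos: "\<forall>\<^sub>F n in sequentially. u n > 0"
    using regularly_varying_eventually_pos[OF rv u] .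
  have "(\<lambda>n. u (nat \<lfloor>2 * real n\<rfloor>) / u n) \<longlonglongrightarrow> 2 powr \<alpha>"
    by (rule regularly_varying_tendsto_nat[OF rv]) simp
  moreover have "nat \<lfloor>2 * real n\<rfloor> = 2 * n" for n by linarith
  ultimately have lim: "(\<lambda>n. u (2 * n) / u n) \<longlonglongrightarrow> 2 powr \<alpha>" by simp
  have "2 powr \<alpha> < 2" "2 powr (-b) < 2 powr \<alpha>"
    using a b powr_less_mono[of \<alpha> 1 2] by auto
  then have "\<forall>\<^sub>F n in sequentially. u (2 * n) / u n < 2"
    "\<forall>\<^sub>F n in sequentially. u (2 * n) / u n > 2 powr (-b)"
    using order_tendstoD[OF lim] by blast+
  then have "\<forall>\<^sub>F n in sequentially. u n > 0 \<and> u (2 * n) \<le> 2 * u n \<and> u n \<le> 2 powr b * u (2 * n)"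
    using pos by eventually_elim (auto simp: powr_minus field_simps)
  then obtain N1 where N1: "\<And>n. n \<ge> N1 \<Longrightarrow> u n > 0"
      "\<And>n. n \<ge> N1 \<Longrightarrow> u (2 * n) \<le> 2 * u n" "\<And>n. n \<ge> N1 \<Longrightarrow> u n \<le> 2 powr b * u (2 * n)"
    by (auto simp: eventually_sequentially)
  define N where "N = N0 + N1 + 1"
  have up: "u k \<le> K * (real k / real n) * u n" if "n \<ge> N" "n \<le> k" for n k
    using that
  proof (induction "k - n" arbitrary: n rule: less_induct)
    case less
    show ?case
    proof (cases "k \<le> 2 * n")
      case True
      then have "u k \<le> K * u n"
        using N0[of n k] less.prems by (auto simp: comparable_def N_def)
      also have "\<dots> \<le> K * (real k / real n) * u n"
        using K u[of n] less.prems
        by (intro mult_right_mono) (auto simp: N_def field_simps)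
      finally show ?thesis .
    next
      case False
      then have "u k \<le> K * (real k / real (2 * n)) * u (2 * n)"
        by (intro less.hyps) (use less.prems in \<open>auto simp: N_def\<close>)
      also have "\<dots> \<le> K * (real k / real (2 * n)) * (2 * u n)"
        by (intro mult_left_mono N1) (use less.prems K in \<open>auto simp: N_def\<close>)
      finally show ?thesis by simp
    qed
  qed
  have down: "u k \<le> K * (real n / real k) powr b * u n" if "k \<ge> N" "k \<le> n" for n k
    using that
  proof (induction "n - k" arbitrary: k rule: less_induct)
    case less
    show ?case
    proof (cases "n \<le> 2 * k")
      case True
      then have "u k \<le> K * 1 * u n"
        using N0[of k n] less.prems by (auto simp: comparable_def N_def)
      also have "\<dots> \<le> K * (real n / real k) powr b * u n"
        using K u[of n] less.prems b
        by (intro mult_right_mono mult_left_mono ge_one_powr_ge_zero) (auto simp: N_def field_simps)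
      finally show ?thesis .
    next
      case False
      have "u k \<le> 2 powr b * u (2 * k)"
        by (rule N1) (use less.prems in \<open>auto simp: N_def\<close>)
      also have "\<dots> \<le> 2 powr b * (K * (real n / real (2 * k)) powr b * u n)"
        using False by (intro mult_left_mono less.hyps) (use less.prems in \<open>auto simp: N_def\<close>)
      also have "\<dots> = K * (real n / real k) powr b * u n"
        using less.prems by (simp add: powr_divide powr_mult N_def)
      finally show ?thesis .
    qed
  qed
  show ?thesis
    by (rule that[OF K _ _ up down]) (auto simp: N_def intro: N1)
qed

section \<open>The Abelian half of Karamata's theorem\<close>

text \<open>Turns a series into an integral in the rescaled variable y = k / n, where dominated
  convergence applies.\<close>

lemma integral_step_function:
  fixes a :: "nat \<Rightarrow> real"
  assumes a: "\<And>k. a k \<ge> 0" "summable a" and n: "n > 0"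
  shows "(\<integral>y. (if 0 \<le> y then a (nat \<lfloor>real n * y\<rfloor>) else 0) \<partial>lborel) = (\<Sum>k. a k) / real n"
proof -
  let ?I = "\<lambda>k. {real k / real n..<real (Suc k) / real n}"
  have mem: "y \<in> ?I k \<longleftrightarrow> 0 \<le> y \<and> k = nat \<lfloor>real n * y\<rfloor>" for k y
  proof -
    have "y \<in> ?I k \<longleftrightarrow> real k \<le> real n * y \<and> real n * y < real k + 1"
      using n by (auto simp: field_simps)
    also have "\<dots> \<longleftrightarrow> 0 \<le> real n * y \<and> k = nat \<lfloor>real n * y\<rfloor>" by linarith
    finally show ?thesis using n by (simp add: zero_le_mult_iff)
  qed
  have sums: "(\<lambda>k. a k * indicator (?I k) y) sums (if 0 \<le> y then a (nat \<lfloor>real n * y\<rfloor>) else 0)" for y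
  proof -
    have "a k * indicator (?I k) y = (if k = nat \<lfloor>real n * y\<rfloor> then if 0 \<le> y then a k else 0 else 0)" for k
      using mem[of y k] by (simp add: indicator_def)
    then show ?thesis
      using sums_single[of "nat \<lfloor>real n * y\<rfloor>" "\<lambda>k. if 0 \<le> y then a k else 0"] by (simp only:)
  qed
  have int: "(\<integral>y. a k * indicator (?I k) y \<partial>lborel) = a k / real n" for k
    using n by (simp add: field_simps)
  have "(\<integral>y. (\<Sum>k. a k * indicator (?I k) y) \<partial>lborel) = (\<Sum>k. \<integral>y. a k * indicator (?I k) y \<partial>lborel)"
  proof (rule integral_suminf)
    show "integrable lborel (\<lambda>y. a k * indicator (?I k) y)" for k
      using n by (intro integrable_mult_right integrable_real_indicator)
        (auto simp: emeasure_lborel_Ico field_simps)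
    show "AE y in lborel. summable (\<lambda>k. norm (a k * indicator (?I k) y))"
      using a(1) sums by (auto simp: abs_mult intro: sums_summable)
    have "norm (a k * indicator (?I k) y) = a k * indicator (?I k) y" for k y
      using a(1)[of k] by simp
    then show "summable (\<lambda>k. \<integral>y. norm (a k * indicator (?I k) y) \<partial>lborel)"
      using summable_divide[OF a(2)] by (simp only: int)
  qed
  also have "\<dots> = (\<Sum>k. a k) / real n"
    unfolding int by (rule suminf_divide[OF a(2)])
  finally show ?thesis using sums_unique[OF sums] by simp
qed

lemma has_bochner_integral_Gamma:
  assumes "s > 0"
  shows "has_bochner_integral lborel (\<lambda>y::real. indicator {0..} y * y powr (s - 1) / exp y) (Gamma s)"
  by (rule has_bochner_integral_nn_integral)
    (use assms in \<open>auto simp: Gamma_conv_nn_integral_real Gamma_real_pos less_imp_le\<close>)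

lemma nat_floor_div_tendsto:
  assumes "y \<ge> 0"
  shows "(\<lambda>n. real (nat \<lfloor>real n * y\<rfloor>) / real n) \<longlonglongrightarrow> y"
proof (rule tendsto_sandwich)
  show "\<forall>\<^sub>F n in sequentially. y - 1 / real n \<le> real (nat \<lfloor>real n * y\<rfloor>) / real n"
    using eventually_gt_at_top[of 0]
  proof eventually_elim
    case (elim n)
    have "real n * y - 1 \<le> real (nat \<lfloor>real n * y\<rfloor>)" by linarith
    then have "(real n * y - 1) / real n \<le> real (nat \<lfloor>real n * y\<rfloor>) / real n"
      by (rule divide_right_mono) simp
    then show ?case using elim by (simp add: diff_divide_distrib)
  qed
  show "\<forall>\<^sub>F n in sequentially. real (nat \<lfloor>real n * y\<rfloor>) / real n \<le> y"
    using eventually_gt_at_top[of 0]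
  proof eventually_elim
    case (elim n)
    have "real (nat \<lfloor>real n * y\<rfloor>) \<le> real n * y" using assms by simp
    then show ?case using elim by (simp add: field_simps)
  qed
  show "(\<lambda>n. y - 1 / real n) \<longlonglongrightarrow> y"
    using tendsto_diff[OF tendsto_const lim_1_over_n, of y] by simp
qed simp

lemma one_minus_inverse_power_tendsto:
  assumes "y \<ge> 0"
  shows "(\<lambda>n. (1 - 1 / real n) ^ nat \<lfloor>real n * y\<rfloor>) \<longlonglongrightarrow> 1 / exp y"
proof -
  have "(\<lambda>n. (1 + (-1) / real n) ^ n) \<longlonglongrightarrow> exp (-1)"
    by (rule tendsto_exp_limit_sequentially)
  then have "(\<lambda>n. ((1 + (-1) / real n) ^ n) powr (real (nat \<lfloor>real n * y\<rfloor>) / real n)) \<longlonglongrightarrow> exp (-1) powr y"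
    by (intro tendsto_powr nat_floor_div_tendsto assms) auto
  moreover have "exp (-1) powr y = 1 / exp y"
    by (simp only: exp_powr_real) (simp add: exp_minus inverse_eq_divide)
  moreover have "\<forall>\<^sub>F n in sequentially. ((1 + (-1) / real n) ^ n) powr (real (nat \<lfloor>real n * y\<rfloor>) / real n) =
      (1 - 1 / real n) ^ nat \<lfloor>real n * y\<rfloor>"
    using eventually_gt_at_top[of 1]
  proof eventually_elim
    case (elim n)
    then have x: "1 - 1 / real n > 0" by simp
    have "((1 - 1 / real n) ^ n) powr (real (nat \<lfloor>real n * y\<rfloor>) / real n) =
        (1 - 1 / real n) powr (real (nat \<lfloor>real n * y\<rfloor>))"
      using x elim by (simp add: powr_powr flip: powr_realpow)
    then show ?case using x by (simp add: powr_realpow)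
  qed
  ultimately show ?thesis using tendsto_cong by force
qed

text \<open>The factor \<open>exp 1\<close> pays for the floor: k / n \<ge> y - 1 / n \<ge> y -
  1.\<close>

lemma one_minus_inverse_power_le:
  assumes "y \<ge> 0" "n > 0"
  shows "(1 - 1 / real n) ^ nat \<lfloor>real n * y\<rfloor> \<le> exp 1 * (1 / exp y)"
proof -
  let ?k = "nat \<lfloor>real n * y\<rfloor>"
  have "(1 - 1 / real n) ^ ?k \<le> exp (- 1 / real n) ^ ?k"
    using exp_ge_add_one_self[of "- 1 / real n"] assms by (intro power_mono) auto
  also have "\<dots> = exp (- (real ?k / real n))"
    by (simp flip: exp_of_nat_mult)
  also have "\<dots> \<le> exp (1 - y)"
  proof -
    have "real n * y - 1 \<le> real ?k" by linarith
    then have "(real n * y - 1) / real n \<le> real ?k / real n" by (rule divide_right_mono) simp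
    moreover have "1 / real n \<le> 1" using assms(2) by simp
    ultimately have "- (real ?k / real n) \<le> 1 - y"
      using assms(2) nonzero_mult_div_cancel_left[of "real n" y]
      unfolding diff_divide_distrib by linarith
    then show ?thesis by simp
  qed
  also have "\<dots> = exp 1 * (1 / exp y)" by (simp add: exp_diff)
  finally show ?thesis .
qed

text \<open>Potter's bounds in terms of y: k \<le> n y serves for k \<ge> n, and n / k \<le> 2 / y
  serves below, because n y < k + 1 \<le> 2 k. Adding the two gives one majorant for both
  ranges.\<close>

lemma regularly_varying_step_bound:
  fixes u :: "nat \<Rightarrow> real"
  assumes N: "N \<ge> 1" and K: "K \<ge> 1" and n: "n \<ge> N" and y: "y \<ge> 0" and k: "k = nat \<lfloor>real n * y\<rfloor>" "k \<ge> N"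
    and b: "b > 0" and u: "u n > 0"
    and up: "n \<le> k \<Longrightarrow> u k \<le> K * (real k / real n) * u n"
    and down: "k \<le> n \<Longrightarrow> u k \<le> K * (real n / real k) powr b * u n"
  shows "u k / u n \<le> K * 2 powr b * (y + y powr (-b))"
proof -
  have pos: "real n > 0" "real k > 0" using N n k(2) by linarith+
  have "real n * y \<ge> 0" using y by simp
  then have le: "real k \<le> real n * y" "real n * y < real k + 1"
    unfolding k(1) by linarith+
  then have y0: "y > 0" using pos y by (cases "y = 0") auto
  have b2: "2 powr b \<ge> 1" using b by (intro ge_one_powr_ge_zero) auto
  show ?thesis
  proof (cases "n \<le> k")
    case True
    have "u k / u n \<le> K * (real k / real n)" using up[OF True] u by (simp add: field_simps)
    also have "\<dots> \<le> K * y" using le pos K by (intro mult_left_mono) (auto simp: field_simps)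
    also have "\<dots> \<le> (K * 2 powr b) * (y + y powr (-b))"
      using K b2 y mult_left_mono[of 1 "2 powr b" K] by (intro mult_mono) auto
    finally show ?thesis .
  next
    case False
    have "real n / real k \<le> 2 / y"
      using le pos y0 N k(2) by (simp add: field_simps)
    then have "(real n / real k) powr b \<le> (2 / y) powr b"
      using b by (intro powr_mono2) auto
    also have "\<dots> = 2 powr b * y powr (-b)"
      using y0 by (simp add: powr_divide powr_minus field_simps)
    finally have "K * (real n / real k) powr b \<le> K * (2 powr b * y powr (-b))"
      using K by (intro mult_left_mono) auto
    also have "\<dots> \<le> K * 2 powr b * (y + y powr (-b))"
      using K y by (simp add: algebra_simps)
    finally have *: "K * (real n / real k) powr b \<le> K * 2 powr b * (y + y powr (-b))" .
    have "u k / u n \<le> K * (real n / real k) powr b" using down False u by (simp add: field_simps)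
    with * show ?thesis by linarith
  qed
qed

text \<open>Divided by n u_n, the sum is essentially the integral of step functions tending to
  y^\<alpha> exp(-y), whose integral over the half-line is Gamma(\<alpha> + 1). Potter's bounds
  supply the majorant.\<close>

theorem Karamata_Abel:
  fixes u :: "nat \<Rightarrow> real"
  assumes rv: "regularly_varying u \<alpha>" and u0: "\<And>n. u n \<ge> 0" and u1: "\<And>n. u n \<le> 1"
    and alpha: "-1 < \<alpha>" "\<alpha> < 1"
  shows "(\<lambda>n. (\<Sum>k. u k * (1 - 1 / real n) ^ k) / (real n * u n)) \<longlonglongrightarrow> Gamma (\<alpha> + 1)"
proof -
  \<comment> \<open>Above -\<alpha>, as Potter's bound requires, and below 1, so that y^(-b) is
    integrable at 0.\<close>
  define b where "b = max ((1 - \<alpha>) / 2) (1 / 2)"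
  have b: "-\<alpha> < b" "0 < b" "b < 1" using alpha by (simp_all add: b_def less_max_iff_disj)
  obtain K N where K: "K \<ge> 1" and N: "N \<ge> 1" and pos: "\<And>n. n \<ge> N \<Longrightarrow> u n > 0"
    and up: "\<And>n k. n \<ge> N \<Longrightarrow> n \<le> k \<Longrightarrow> u k \<le> K * (real k / real n) * u n"
    and down: "\<And>n k. k \<ge> N \<Longrightarrow> k \<le> n \<Longrightarrow> u k \<le> K * (real n / real k) powr b * u n"
    using regularly_varying_Potter[OF rv u0 alpha(2) b(1,2)] by metis
  define x where "x n = 1 - 1 / real n" for n
  \<comment> \<open>Potter's bounds start at N, so the head of the series is cut off here and shown
    to be negligible separately.\<close>
  define v where "v k = (if k \<ge> N then u k else 0)" for k
  define a where "a n k = v k * x n ^ k / u n" for n k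
  define f where "f n y = (if 0 \<le> y then a n (nat \<lfloor>real n * y\<rfloor>) else 0)" for n and y :: real
  define h where "h y = indicator {0..} y * y powr (\<alpha> + 1 - 1) / exp y" for y :: real
  \<comment> \<open>Up to a constant, the Gamma integrands with parameters 2 and 1 - b, matching y +
    y^(-b).\<close>
  define w where "w y = exp 1 * K * 2 powr b *
    (indicator {0..} y * y powr (2 - 1) / exp y + indicator {0..} y * y powr (1 - b - 1) / exp y)" for y :: real
  have x: "0 \<le> x n" "x n < 1" if "n \<ge> 1" for n using that by (auto simp: x_def)
  have summ: "summable (\<lambda>k. c k * x n ^ k)" if "n \<ge> 1" "\<And>k. 0 \<le> c k" "\<And>k. c k \<le> 1" for c n
  proof (rule summable_comparison_test')
    show "summable (\<lambda>k. x n ^ k)" using x[OF that(1)] by (intro summable_geometric) auto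
    show "norm (c k * x n ^ k) \<le> x n ^ k" if "k \<ge> 0" for k
      using that \<open>\<And>k. 0 \<le> c k\<close>[of k] \<open>\<And>k. c k \<le> 1\<close>[of k] x[OF \<open>n \<ge> 1\<close>]
      by (simp add: abs_mult mult_left_le_one_le)
  qed
  have v: "0 \<le> v k" "v k \<le> 1" for k using u0 u1 by (auto simp: v_def)
  have h_int: "has_bochner_integral lborel h (Gamma (\<alpha> + 1))"
    unfolding h_def by (rule has_bochner_integral_Gamma) (use alpha in simp)
  have Gamma_int: "integrable lborel (\<lambda>y::real. indicator {0..} y * y powr (s - 1) / exp y)" if "s > 0" for s
    using has_bochner_integral_Gamma[OF that] by (rule integrable.intros)
  have w_int: "integrable lborel w"
    unfolding w_def by (intro integrable_mult_right Bochner_Integration.integrable_add Gamma_int) (use b in simp_all)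
  have bound: "norm (f n y) \<le> w y" if n: "n \<ge> N" for n y
  proof (cases "y \<ge> 0 \<and> nat \<lfloor>real n * y\<rfloor> \<ge> N")
    case False
    moreover have "w y \<ge> 0" using K by (auto simp: w_def)
    ultimately show ?thesis by (auto simp: f_def a_def v_def)
  next
    case True
    define k where "k = nat \<lfloor>real n * y\<rfloor>"
    have y: "y \<ge> 0" and k: "k \<ge> N" using True by (auto simp: k_def)
    have "y \<noteq> 0" using k N by (auto simp: k_def)
    have "norm (f n y) = (u k / u n) * x n ^ k"
      using y k u0 x[of n] N n by (simp add: f_def a_def v_def flip: k_def)
    also have "\<dots> \<le> (K * 2 powr b * (y + y powr (-b))) * (exp 1 * (1 / exp y))"
    proof (rule mult_mono)
      show "u k / u n \<le> K * 2 powr b * (y + y powr (-b))"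
        by (rule regularly_varying_step_bound[OF N K n y k_def k b(2)])
          (use n k pos up down in auto)
      show "x n ^ k \<le> exp 1 * (1 / exp y)"
        unfolding x_def k_def by (rule one_minus_inverse_power_le) (use y n N in auto)
    qed (use K y x[of n] N n in auto)
    also have "\<dots> = w y"
      using y \<open>y \<noteq> 0\<close> by (simp add: w_def add_divide_distrib distrib_left mult_ac)
    finally show ?thesis .
  qed
  have lim: "(\<lambda>n. f n y) \<longlonglongrightarrow> h y" if "y \<noteq> 0" for y
  proof (cases "y > 0")
    case True
    have "(\<lambda>n. (u (nat \<lfloor>y * real n\<rfloor>) / u n) * (1 - 1 / real n) ^ nat \<lfloor>real n * y\<rfloor>) \<longlonglongrightarrow> y powr \<alpha> * (1 / exp y)"
      using True by (intro tendsto_mult regularly_varying_tendsto_nat[OF rv] one_minus_inverse_power_tendsto) auto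
    moreover have "\<forall>\<^sub>F n in sequentially. (u (nat \<lfloor>y * real n\<rfloor>) / u n) * (1 - 1 / real n) ^ nat \<lfloor>real n * y\<rfloor> = f n y"
    proof -
      obtain M :: nat where M: "real M \<ge> real N / y" using real_arch_simple by blast
      have "nat \<lfloor>y * real n\<rfloor> \<ge> N" if "n \<ge> M" for n
      proof -
        have "real N / y \<le> real n" using M that by linarith
        then have "real N \<le> y * real n" using True by (simp add: field_simps)
        then show ?thesis by linarith
      qed
      then show ?thesis using True
        by (intro eventually_mono[OF eventually_ge_at_top[of M]])
          (auto simp: f_def a_def v_def x_def mult.commute)
    qed
    ultimately show ?thesis using True
      by (auto simp: h_def intro: Lim_transform_eventually)
  next
    case False
    then show ?thesis using that by (simp add: f_def h_def)
  qed
  have "(\<lambda>n. \<integral>y. f (n + N) y \<partial>lborel) \<longlonglongrightarrow> (\<integral>y. h y \<partial>lborel)"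
  proof (rule integral_dominated_convergence[OF _ _ w_int])
    show "h \<in> borel_measurable lborel" using h_int by (auto dest: has_bochner_integral_integrable)
    show "f (n + N) \<in> borel_measurable lborel" for n unfolding f_def by measurable
    show "AE y in lborel. (\<lambda>n. f (n + N) y) \<longlonglongrightarrow> h y"
      using AE_lborel_singleton[of 0] by eventually_elim (intro LIMSEQ_ignore_initial_segment lim)
    show "AE y in lborel. norm (f (n + N) y) \<le> w y" for n
      using bound[of "n + N"] by auto
  qed
  then have "(\<lambda>n. \<integral>y. f n y \<partial>lborel) \<longlonglongrightarrow> Gamma (\<alpha> + 1)"
    unfolding has_bochner_integral_integral_eq[OF h_int] by (rule LIMSEQ_offset)
  \<comment> \<open>The head is at most N, and Potter's bound with k = N makes 1 / u_n at most of
    order n^b; the quotient is O(n^(b-1)).\<close>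
  moreover have "(\<lambda>n. (\<Sum>k<N. u k * x n ^ k) / (real n * u n)) \<longlonglongrightarrow> 0"
  proof (rule Lim_null_comparison)
    define c where "c = real N * K * (1 / real N) powr b / u N"
    show "\<forall>\<^sub>F n in sequentially. norm ((\<Sum>k<N. u k * x n ^ k) / (real n * u n)) \<le> c * real n powr (b - 1)"
      using eventually_ge_at_top[of N]
    proof eventually_elim
      case (elim n)
      have n: "real n > 0" "n \<ge> 1" using elim N by auto
      have uN: "u N > 0" "u n > 0" using pos elim by auto
      have "(\<Sum>k<N. u k * x n ^ k) \<le> (\<Sum>k<N. 1)"
        using u0 u1 x[OF n(2)] by (intro sum_mono mult_le_one) (auto simp: power_le_one)
      then have "(\<Sum>k<N. u k * x n ^ k) / (real n * u n) \<le> real N / (real n * u n)"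
        using n uN by (intro divide_right_mono) auto
      also have "1 / u n \<le> K * (real n / real N) powr b / u N"
        using down[of N n] elim uN by (simp add: field_simps)
      then have "real N / real n * (1 / u n) \<le> real N / real n * (K * (real n / real N) powr b / u N)"
        by (intro mult_left_mono) auto
      then have "real N / (real n * u n) \<le> real N / real n * (K * (real n / real N) powr b / u N)"
        by simp
      also have "\<dots> = c * real n powr (b - 1)"
        using n N by (simp add: c_def powr_divide powr_diff field_simps)
      finally show ?case
        using n uN u0 x[OF n(2)] by (simp add: abs_of_nonneg sum_nonneg)
    qed
    show "(\<lambda>n. c * real n powr (b - 1)) \<longlonglongrightarrow> 0"
      using b by (intro tendsto_mult_right_zero tendsto_neg_powr filterlim_real_sequentially) auto
  qed
  ultimately have "(\<lambda>n. (\<integral>y. f n y \<partial>lborel) + (\<Sum>k<N. u k * x n ^ k) / (real n * u n)) \<longlonglongrightarrow> Gamma (\<alpha> + 1) + 0"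
    by (rule tendsto_add)
  moreover have "\<forall>\<^sub>F n in sequentially. (\<integral>y. f n y \<partial>lborel) + (\<Sum>k<N. u k * x n ^ k) / (real n * u n) =
     (\<Sum>k. u k * (1 - 1 / real n) ^ k) / (real n * u n)"
    using eventually_ge_at_top[of N]
  proof eventually_elim
    case (elim n)
    have n: "n \<ge> 1" using elim N by auto
    have "(\<integral>y. f n y \<partial>lborel) = (\<Sum>k. a n k) / real n"
      unfolding f_def
      by (rule integral_step_function)
        (use n v x[OF n] u0 summ[OF n v] in \<open>auto simp: a_def intro: summable_divide\<close>)
    also have "(\<Sum>k. a n k) = (\<Sum>k. v k * x n ^ k) / u n"
      unfolding a_def by (rule suminf_divide[OF summ[OF n v]])
    finally have f: "(\<integral>y. f n y \<partial>lborel) = (\<Sum>k. v k * x n ^ k) / (real n * u n)"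
      by (simp add: mult.commute)
    have "(\<Sum>k. u k * x n ^ k) = (\<Sum>k. u (k + N) * x n ^ (k + N)) + (\<Sum>k<N. u k * x n ^ k)"
      by (rule suminf_split_initial_segment[OF summ[OF n u0 u1]])
    moreover have "(\<Sum>k. v k * x n ^ k) = (\<Sum>k. u (k + N) * x n ^ (k + N)) + 0"
      by (subst suminf_split_initial_segment[OF summ[OF n v], where k = N]) (simp add: v_def)
    ultimately show ?case unfolding f x_def by (simp add: add_divide_distrib)
  qed
  ultimately show ?thesis by (auto intro: Lim_transform_eventually)
qed

section \<open>Polynomials with nonnegative coefficients\<close>

lemma convergent_uniform_approx:
  fixes x :: "nat \<Rightarrow> 'a :: banach"
  assumes "\<And>e. e > 0 \<Longrightarrow> \<exists>y. convergent y \<and> (\<forall>n. norm (x n - y n) \<le> e)"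
  shows "convergent x"
proof -
  have "Cauchy x"
  proof (rule CauchyI)
    fix e :: real assume "e > 0"
    then obtain y where y: "convergent y" "\<And>n. norm (x n - y n) \<le> e / 4"
      using assms[of "e / 4"] by auto
    obtain M where M: "\<And>m n. m \<ge> M \<Longrightarrow> n \<ge> M \<Longrightarrow> norm (y m - y n) < e / 2"
      using CauchyD[OF convergent_Cauchy[OF y(1)], of "e / 2"] \<open>e > 0\<close> by auto
    have "norm (x m - x n) < e" if "m \<ge> M" "n \<ge> M" for m n
    proof -
      have "norm (x m - x n) = norm ((x m - y m) + (y m - y n) + (y n - x n))" by simp
      also have "\<dots> \<le> norm (x m - y m) + norm (y m - y n) + norm (y n - x n)"
        by (intro order_trans[OF norm_triangle_ineq] add_right_mono norm_triangle_ineq)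
      finally have "norm (x m - x n) \<le> norm (x m - y m) + norm (y m - y n) + norm (x n - y n)"
        by (simp only: norm_minus_commute[of "y n"])
      then show ?thesis using y(2)[of m] y(2)[of n] M[OF that] by linarith
    qed
    then show "\<exists>M. \<forall>m\<ge>M. \<forall>n\<ge>M. norm (x m - x n) < e" by blast
  qed
  then show ?thesis by (rule Cauchy_convergent)
qed

lemma poly_sums: "(\<lambda>i. coeff p i * x ^ i) sums poly p (x :: real)"
  unfolding poly_altdef by (rule sums_finite) (auto simp: coeff_eq_0)

text \<open>One nonnegative term is at most the whole sum, and passing from r to q shrinks every
  term of degree at least j by (q / r)^j or more.\<close>

lemma nonneg_poly_bounds:
  fixes p :: "real poly"
  assumes nn: "\<And>i. coeff p i \<ge> 0" and B: "poly p r \<le> B" and r: "r > 0"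
  shows nonneg_poly_coeff_bound: "coeff p i \<le> B / r ^ i"
    and nonneg_poly_tail_bound: "0 \<le> q \<Longrightarrow> q \<le> r \<Longrightarrow>
      0 \<le> poly p q - (\<Sum>i<j. coeff p i * q ^ i) \<and> poly p q - (\<Sum>i<j. coeff p i * q ^ i) \<le> (q / r) ^ j * B"
proof -
  have nnt: "coeff p i * x ^ i \<ge> 0" if "x \<ge> 0" for x i using nn that by auto
  have "coeff p i * r ^ i \<le> poly p r"
    using sum_le_suminf[OF sums_summable[OF poly_sums[of p r]], of "{i}"] nnt r
    by (simp add: sums_unique[OF poly_sums, symmetric])
  then show "coeff p i \<le> B / r ^ i" using B r by (simp add: field_simps)
  show "0 \<le> poly p q - (\<Sum>i<j. coeff p i * q ^ i) \<and> poly p q - (\<Sum>i<j. coeff p i * q ^ i) \<le> (q / r) ^ j * B"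
    if q: "0 \<le> q" "q \<le> r"
  proof
    have tail: "(\<lambda>i. coeff p (i + j) * x ^ (i + j)) sums (poly p x - (\<Sum>i<j. coeff p i * x ^ i))" for x :: real
      using poly_sums by (rule sums_split_initial_segment)
    show "0 \<le> poly p q - (\<Sum>i<j. coeff p i * q ^ i)"
      by (rule sums_le[OF _ sums_zero tail]) (use nnt q in auto)
    have "coeff p (i + j) * q ^ (i + j) \<le> (q / r) ^ j * (coeff p (i + j) * r ^ (i + j))" for i
    proof -
      have "q ^ (i + j) = (q / r) ^ j * (q ^ i * r ^ j)" using r by (simp add: power_add power_divide)
      also have "\<dots> \<le> (q / r) ^ j * (r ^ i * r ^ j)"
        using q r by (intro mult_left_mono mult_right_mono power_mono) auto
      finally have "coeff p (i + j) * q ^ (i + j) \<le> coeff p (i + j) * ((q / r) ^ j * r ^ (i + j))"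
        using nn by (intro mult_left_mono) (auto simp: power_add)
      then show ?thesis by (simp add: mult.left_commute)
    qed
    then have "poly p q - (\<Sum>i<j. coeff p i * q ^ i) \<le> (q / r) ^ j * (poly p r - (\<Sum>i<j. coeff p i * r ^ i))"
      by (rule sums_le[OF _ tail sums_mult[OF tail]])
    also have "\<dots> \<le> (q / r) ^ j * B"
    proof (rule mult_left_mono)
      have "0 \<le> (\<Sum>i<j. coeff p i * r ^ i)" using nnt r by (intro sum_nonneg) auto
      with B show "poly p r - (\<Sum>i<j. coeff p i * r ^ i) \<le> B" by linarith
    qed (use q r in auto)
    finally show "poly p q - (\<Sum>i<j. coeff p i * q ^ i) \<le> (q / r) ^ j * B" .
  qed
qed

text \<open>A version of Vitali's theorem in which nonnegativity of the coefficients replaces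
  complex arguments.\<close>

theorem nonneg_poly_pointwise_limit:
  fixes A :: "nat \<Rightarrow> real poly"
  assumes nn: "\<And>n i. coeff (A n) i \<ge> 0"
    and lim: "\<And>q. 0 < q \<Longrightarrow> q < 1 \<Longrightarrow> (\<lambda>n. poly (A n) q) \<longlonglongrightarrow> F q"
  obtains L :: "real fps" where "\<And>j. (\<lambda>n. coeff (A n) j) \<longlonglongrightarrow> fps_nth L j"
    "\<And>q. 0 < q \<Longrightarrow> q < 1 \<Longrightarrow> (\<lambda>j. fps_nth L j * q ^ j) sums F q"
proof -
  have bdd: "\<exists>B. \<forall>n. poly (A n) r \<le> B" if "0 < r" "r < 1" for r
    using Bseq_bdd_above[OF convergent_imp_Bseq[OF convergentI[OF lim[OF that]]]]
    by (auto simp: bdd_above_def)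
  \<comment> \<open>The j-th coefficient is approximated by the remainder after j terms divided by
    q^j, for a small fixed q. This converges by the induction hypothesis, and the error is O(q)
    uniformly in n.\<close>
  have conv: "convergent (\<lambda>n. coeff (A n) j)" for j
  proof (induction j rule: less_induct)
    case (less j)
    obtain B where B: "\<And>n. poly (A n) (1/2) \<le> B" using bdd[of "1/2"] by auto
    have "B \<ge> 0" using nn[of 0 0] nonneg_poly_coeff_bound[OF nn B, of 0 0] by simp
    show ?case
    proof (rule convergent_uniform_approx)
      fix e :: real assume e: "e > 0"
      \<comment> \<open>Makes the error q 2^(j+1) B at most e; the power of 2 comes from the tail
        bound at radius 1/2, and B + 1 keeps the divisor positive.\<close>
      define q where "q = min (1/2) (e / (2 ^ Suc j * (B + 1)))"
      have q: "0 < q" "q \<le> 1/2" "q \<le> e / (2 ^ Suc j * (B + 1))"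
        using e \<open>B \<ge> 0\<close> unfolding q_def by (simp, simp only: min.cobounded1, simp only: min.cobounded2)
      define y where "y n = (poly (A n) q - (\<Sum>i<j. coeff (A n) i * q ^ i)) / q ^ j" for n
      have "convergent (\<lambda>n. (poly (A n) q - (\<Sum>i<j. coeff (A n) i * q ^ i)) * (1 / q ^ j))"
        using convergentI[OF lim[of q]] q
        by (intro convergent_mult convergent_diff convergent_sum convergent_const less) auto
      then have "convergent y" by (simp add: y_def[abs_def])
      moreover have "norm (coeff (A n) j - y n) \<le> e" for n
      proof -
        define t where "t = poly (A n) q - (\<Sum>i<Suc j. coeff (A n) i * q ^ i)"
        have "0 \<le> t \<and> t \<le> (q / (1/2)) ^ Suc j * B"
          unfolding t_def by (rule nonneg_poly_tail_bound[OF nn B]) (use q in auto)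
        then have t: "0 \<le> t" "t \<le> (q / (1/2)) ^ Suc j * B" by auto
        have "t = (poly (A n) q - (\<Sum>i<j. coeff (A n) i * q ^ i)) - coeff (A n) j * q ^ j"
          by (simp add: t_def)
        then have "y n - coeff (A n) j = t / q ^ j"
          using q by (simp add: y_def diff_divide_distrib)
        moreover have "t / q ^ j \<le> (q / (1/2)) ^ Suc j * B / q ^ j"
          using t q by (intro divide_right_mono) auto
        moreover have "(q / (1/2)) ^ Suc j * B / q ^ j = q * (2 ^ Suc j * B)"
          using q by (simp add: power_mult_distrib)
        moreover have "q * (2 ^ Suc j * B) \<le> (e / (2 ^ Suc j * (B + 1))) * (2 ^ Suc j * B)"
          using \<open>B \<ge> 0\<close> q(3) by (intro mult_right_mono) auto
        moreover have "(e / (2 ^ Suc j * (B + 1))) * (2 ^ Suc j * B) = e * (B / (B + 1))"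
          by simp
        moreover have "e * (B / (B + 1)) \<le> e"
          using \<open>B \<ge> 0\<close> e by (intro mult_left_le) auto
        moreover have "t / q ^ j \<ge> 0" using t q by simp
        ultimately show ?thesis unfolding real_norm_def by linarith
      qed
      ultimately show "\<exists>y. convergent y \<and> (\<forall>n. norm (coeff (A n) j - y n) \<le> e)" by blast
    qed
  qed
  define L where "L = Abs_fps (\<lambda>j. lim (\<lambda>n. coeff (A n) j))"
  have L: "(\<lambda>n. coeff (A n) j) \<longlonglongrightarrow> fps_nth L j" for j
    using conv[of j] by (simp add: L_def convergent_LIMSEQ_iff)
  show ?thesis
  proof (rule that[OF L])
    fix q :: real assume q: "0 < q" "q < 1"
    \<comment> \<open>A radius strictly between q and 1 makes B (q / r)^k a summable majorant,
      uniform in n, for Tannery's theorem.\<close>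
    define r where "r = (1 + q) / 2"
    have r: "q < r" "0 < r" "r < 1" using q by (auto simp: r_def)
    obtain B where B: "\<And>n. poly (A n) r \<le> B" using bdd r by blast
    have "norm (coeff (A n) k * q ^ k) \<le> B * (q / r) ^ k" for n k
    proof -
      have "coeff (A n) k * q ^ k \<le> B / r ^ k * q ^ k"
        using q by (intro mult_right_mono nonneg_poly_coeff_bound[OF nn B r(2)]) auto
      then show ?thesis using nn[of n k] q by (simp add: abs_mult power_divide)
    qed
    then have T: "summable (\<lambda>k. norm (fps_nth L k * q ^ k)) \<and>
        ((\<lambda>n. \<Sum>k. coeff (A n) k * q ^ k) \<longlonglongrightarrow> (\<Sum>k. fps_nth L k * q ^ k))"
      using tannerys_theorem[of "\<lambda>k n. coeff (A n) k * q ^ k" "\<lambda>k. fps_nth L k * q ^ k" sequentially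
          "\<lambda>k. B * (q / r) ^ k"] q r
      by (auto intro!: tendsto_mult L always_eventually summable_mult summable_geometric)
    have "(\<lambda>n. \<Sum>k. coeff (A n) k * q ^ k) \<longlonglongrightarrow> F q"
      using lim[OF q] by (simp add: sums_unique[OF poly_sums, symmetric])
    then have "(\<Sum>k. fps_nth L k * q ^ k) = F q"
      using T LIMSEQ_unique by blast
    then show "(\<lambda>j. fps_nth L j * q ^ j) sums F q"
      using summable_sums[OF summable_norm_cancel[OF conjunct1[OF T]]] by simp
  qed
qed

section \<open>Renewal sequences and the q-difference equation\<close>

text \<open>Applied to p(z) = \<phi>(\<zeta>z), whose coefficients form a probability distribution;
  1 / (1 - p) generates its renewal sequence.\<close>

locale subprobability_fps =
  fixes p :: "real fps"
  assumes p0: "fps_nth p 0 = 0" and p_nonneg: "\<And>i. fps_nth p i \<ge> 0"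
    and p_sum: "\<And>n. (\<Sum>i\<le>n. fps_nth p i) \<le> 1"
begin

lemma p_average_le:
  assumes "\<And>k. k < n \<Longrightarrow> v k \<le> B" "B \<ge> 0"
  shows "(\<Sum>k<n. fps_nth p (n - k) * v k) \<le> B"
proof -
  have "(\<Sum>k<n. fps_nth p (n - k) * v k) \<le> (\<Sum>k<n. fps_nth p (n - k) * B)"
    using assms(1) p_nonneg by (intro sum_mono mult_left_mono) auto
  also have "(\<Sum>k<n. fps_nth p (n - k) * B) = (\<Sum>i\<in>{1..n}. fps_nth p i) * B"
    unfolding sum_distrib_right
    by (rule sum.reindex_bij_witness[of _ "\<lambda>i. n - i" "\<lambda>k. n - k"]) auto
  also have "(\<Sum>i\<in>{1..n}. fps_nth p i) \<le> (\<Sum>i\<le>n. fps_nth p i)"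
    using p_nonneg by (intro sum_mono2) auto
  then have "(\<Sum>i\<in>{1..n}. fps_nth p i) * B \<le> 1 * B"
    using p_sum[of n] assms(2) by (intro mult_right_mono) auto
  finally show ?thesis by simp
qed

lemma one_minus_p_inverse: "(1 - p) * inverse (1 - p) = 1"
  using p0 by (intro inverse_mult_eq_1') simp

lemma renewal_nth_0: "fps_nth (inverse (1 - p)) 0 = 1"
  using p0 by simp

lemma renewal_nth:
  "n > 0 \<Longrightarrow> fps_nth (inverse (1 - p)) n = (\<Sum>k<n. fps_nth p (n - k) * fps_nth (inverse (1 - p)) k)"
  using arg_cong[OF one_minus_p_inverse, of "\<lambda>h. fps_nth h n"]
  by (simp add: left_diff_distrib fps_mult_nth_0_left[OF p0])

lemma renewal_bounds: "0 \<le> fps_nth (inverse (1 - p)) n \<and> fps_nth (inverse (1 - p)) n \<le> 1"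
proof (induction n rule: less_induct)
  case (less n)
  show ?case
  proof (cases "n = 0")
    case False
    then show ?thesis
      using renewal_nth[of n] less p_nonneg p_average_le[of n "fps_nth (inverse (1 - p))" 1]
      by (auto intro!: sum_nonneg)
  qed (simp add: p0)
qed

context
  fixes q :: real and P :: "real fps"
  assumes q: "0 < q" "q < 1" and P0: "fps_nth P 0 = 1" and P: "(1 - p) * P = fps_dilate q P"
begin

lemma eigen_nth: "(1 - q ^ n) * fps_nth P n = (\<Sum>k<n. fps_nth p (n - k) * fps_nth P k)"
  using arg_cong[OF P, of "\<lambda>h. fps_nth h n"]
  by (simp add: left_diff_distrib fps_mult_nth_0_left[OF p0])

text \<open>The recursion averages earlier values with total weight at most 1 and divides by 1 -
  q^n. This loses at most a factor exp(q^n / (1 - q)), and the product of these factors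
  converges.\<close>

lemma eigen_nth_bounds: "0 \<le> fps_nth P n \<and> fps_nth P n \<le> exp (\<Sum>i\<le>n. q ^ i / (1 - q))"
proof (induction n rule: less_induct)
  case (less n)
  show ?case
  proof (cases n)
    case 0
    then show ?thesis using P0 q by simp
  next
    case (Suc m)
    have "q ^ n \<le> q ^ 1" using q Suc by (intro power_decreasing) auto
    then have qn: "q ^ n < 1" "q ^ n \<le> q" using q by auto
    have "0 \<le> (1 - q ^ n) * fps_nth P n"
      unfolding eigen_nth using p_nonneg less by (intro sum_nonneg) auto
    then have nn: "0 \<le> fps_nth P n" using qn by (simp add: zero_le_mult_iff)
    have "(1 - q ^ n) * fps_nth P n \<le> exp (\<Sum>i\<le>m. q ^ i / (1 - q))"
      unfolding eigen_nth
    proof (rule p_average_le)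
      fix k assume k: "k < n"
      have "fps_nth P k \<le> exp (\<Sum>i\<le>k. q ^ i / (1 - q))" using less k by auto
      also have "\<dots> \<le> exp (\<Sum>i\<le>m. q ^ i / (1 - q))"
        using k Suc q by (simp, intro sum_mono2) auto
      finally show "fps_nth P k \<le> exp (\<Sum>i\<le>m. q ^ i / (1 - q))" .
    qed simp
    then have "fps_nth P n \<le> exp (\<Sum>i\<le>m. q ^ i / (1 - q)) * (1 / (1 - q ^ n))"
      using qn by (simp add: field_simps)
    also have "1 / (1 - q ^ n) \<le> exp (q ^ n / (1 - q))"
    proof -
      have "1 / (1 - q ^ n) = 1 + q ^ n / (1 - q ^ n)" using qn by (simp add: field_simps)
      also have "q ^ n / (1 - q ^ n) \<le> q ^ n / (1 - q)" using qn q by (intro divide_left_mono) auto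
      finally show ?thesis using exp_ge_add_one_self[of "q ^ n / (1 - q)"] by linarith
    qed
    then have "exp (\<Sum>i\<le>m. q ^ i / (1 - q)) * (1 / (1 - q ^ n)) \<le>
        exp (\<Sum>i\<le>m. q ^ i / (1 - q)) * exp (q ^ n / (1 - q))"
      by (rule mult_left_mono) simp
    also have "\<dots> = exp (\<Sum>i\<le>n. q ^ i / (1 - q))" using Suc by (simp add: exp_add)
    finally show ?thesis using nn by simp
  qed
qed

lemma eigen_bounded: "0 \<le> fps_nth P n" "fps_nth P n \<le> exp (1 / (1 - q) ^ 2)"
proof -
  show "0 \<le> fps_nth P n" using eigen_nth_bounds by simp
  have "(\<Sum>i\<le>n. q ^ i) \<le> 1 / (1 - q)"
    using q sum_le_suminf[OF summable_geometric, of q "{..n}"] by (simp add: suminf_geometric)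
  then have "(\<Sum>i\<le>n. q ^ i) / (1 - q) \<le> 1 / (1 - q) / (1 - q)"
    using q by (intro divide_right_mono) auto
  then have "(\<Sum>i\<le>n. q ^ i / (1 - q)) \<le> 1 / (1 - q) ^ 2"
    by (simp add: sum_divide_distrib power2_eq_square)
  then show "fps_nth P n \<le> exp (1 / (1 - q) ^ 2)"
    using eigen_nth_bounds[of n] by (meson exp_le_cancel_iff order_trans)
qed

text \<open>The second factor has coefficients q^m P_m, which decay geometrically since
  \<open>P\<close> is bounded; hence \<open>P\<close> inherits its asymptotics from the renewal
  sequence.\<close>

lemma eigen_renewal: "P = inverse (1 - p) * fps_dilate q P"
  using one_minus_p_inverse by (metis P mult.assoc mult.commute mult.left_neutral)

end

end

lemma fps_conv_radius_bounded:
  fixes h :: "real fps"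
  assumes "\<And>n. \<bar>fps_nth h n\<bar> \<le> B"
  shows "fps_conv_radius h \<ge> 1"
  unfolding fps_conv_radius_def
proof (rule conv_radius_geI_ex)
  fix r :: real assume r: "0 < r" "ereal r < 1"
  have "summable (\<lambda>n. fps_nth h n * r ^ n)"
  proof (rule summable_comparison_test')
    show "summable (\<lambda>n. B * r ^ n)" using r by (intro summable_mult summable_geometric) auto
    show "norm (fps_nth h n * r ^ n) \<le> B * r ^ n" if "n \<ge> 0" for n
      using assms[of n] r by (simp add: abs_mult mult_right_mono)
  qed
  then show "\<exists>z. norm z = r \<and> summable (\<lambda>n. fps_nth h n * z ^ n)"
    using r by (intro exI[of _ r]) auto
qed

context subprobability_fps
begin

lemma fps_conv_radius_p: "fps_conv_radius p \<ge> 1"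
proof (rule fps_conv_radius_bounded)
  fix n
  have "fps_nth p n \<le> (\<Sum>i\<le>n. fps_nth p i)" using p_nonneg by (intro member_le_sum) auto
  then show "\<bar>fps_nth p n\<bar> \<le> 1" using p_sum[of n] p_nonneg[of n] by linarith
qed

lemma renewal_eval:
  assumes "\<bar>x\<bar> < 1"
  shows "(1 - eval_fps p x) * (\<Sum>n. fps_nth (inverse (1 - p)) n * x ^ n) = 1"
proof -
  let ?u = "inverse (1 - p)"
  have "\<bar>fps_nth ?u n\<bar> \<le> 1" for n using renewal_bounds[of n] by auto
  then have "fps_conv_radius ?u \<ge> 1" by (rule fps_conv_radius_bounded)
  then have x: "ereal (norm x) < fps_conv_radius ?u" "ereal (norm x) < fps_conv_radius p"
    "ereal (norm x) < fps_conv_radius (1 - p)"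
    using assms fps_conv_radius_p fps_conv_radius_diff[of 1 p]
    by (auto intro: less_le_trans[of _ 1])
  have "eval_fps ((1 - p) * ?u) x = (1 - eval_fps p x) * eval_fps ?u x"
    using x by (simp add: eval_fps_mult eval_fps_diff)
  then show ?thesis unfolding one_minus_p_inverse by (simp add: eval_fps_def[of ?u])
qed

text \<open>The equation (1 - p(x)) P(x) = P(qx) telescopes along x = q, q^2, ...; n factors
  multiply to P(q^(n+1)) / P(q), and P(x) -> 1 at 0. Starting at q stays inside the unit disc, where
  the series converge.\<close>

lemma eigen_eval_has_prod:
  assumes q: "0 < q" "q < 1" and P0: "fps_nth P 0 = 1" and P: "(1 - p) * P = fps_dilate q P"
  shows "(\<lambda>j. 1 - eval_fps p (q ^ Suc j)) has_prod (1 / eval_fps P q)" and "eval_fps P q > 0"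
proof -
  note bd = eigen_bounded[OF q P0 P]
  have "fps_conv_radius P \<ge> 1"
    by (rule fps_conv_radius_bounded[where B = "exp (1 / (1 - q) ^ 2)"]) (use bd in auto)
  then have rad: "ereal (norm x) < fps_conv_radius P" "ereal (norm x) < fps_conv_radius p"
    "ereal (norm x) < fps_conv_radius (1 - p)" if "\<bar>x\<bar> < 1" for x :: real
    using that fps_conv_radius_p fps_conv_radius_diff[of 1 p]
    by (auto intro: less_le_trans[of _ 1])
  have step: "(1 - eval_fps p x) * eval_fps P x = eval_fps P (q * x)" if "\<bar>x\<bar> < 1" for x
  proof -
    have "(1 - eval_fps p x) * eval_fps P x = eval_fps ((1 - p) * P) x"
      using rad[OF that] by (simp add: eval_fps_mult eval_fps_diff)
    also have "\<dots> = eval_fps P (q * x)"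
      unfolding P by (simp add: eval_fps_def power_mult_distrib mult_ac)
    finally show ?thesis .
  qed
  have qn: "\<bar>q ^ Suc n\<bar> < 1" for n
  proof -
    have "q ^ Suc n \<le> q ^ 1" using q by (intro power_decreasing) auto
    moreover have "0 \<le> q ^ Suc n" using q by simp
    ultimately show ?thesis using q by (simp only: abs_of_nonneg power_one_right)
  qed
  have prod: "(\<Prod>j<n. 1 - eval_fps p (q ^ Suc j)) * eval_fps P q = eval_fps P (q ^ Suc n)" for n
  proof (induction n)
    case (Suc n)
    have "(\<Prod>j<Suc n. 1 - eval_fps p (q ^ Suc j)) * eval_fps P q =
        (1 - eval_fps p (q ^ Suc n)) * ((\<Prod>j<n. 1 - eval_fps p (q ^ Suc j)) * eval_fps P q)"
      by (simp add: mult_ac)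
    also have "\<dots> = eval_fps P (q * q ^ Suc n)" unfolding Suc by (rule step[OF qn])
    finally show ?case by simp
  qed simp
  have P_sums: "(\<lambda>n. fps_nth P n * q ^ n) sums eval_fps P q"
    by (rule sums_eval_fps) (use rad[of q] q in auto)
  \<comment> \<open>P(q) is at least its constant term 1, so the division is legitimate and the
    limit of the partial products is nonzero, as \<open>has_prod\<close> demands.\<close>
  have "(\<Sum>n\<in>{0}. fps_nth P n * q ^ n) \<le> (\<Sum>n. fps_nth P n * q ^ n)"
    by (rule sum_le_suminf[OF sums_summable[OF P_sums]]) (use bd q in auto)
  then have "fps_nth P 0 \<le> eval_fps P q" by (simp add: sums_unique[OF P_sums, symmetric])
  then show pos: "eval_fps P q > 0" using P0 by simp
  have "isCont (eval_fps P) 0"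
    by (rule continuous_eval_fps) (use rad[of 0] in auto)
  moreover have "(\<lambda>n. q ^ Suc (Suc n)) \<longlonglongrightarrow> 0"
    by (intro LIMSEQ_Suc LIMSEQ_realpow_zero) (use q in auto)
  ultimately have "(\<lambda>n. eval_fps P (q ^ Suc (Suc n))) \<longlonglongrightarrow> eval_fps P 0"
    by (rule isCont_tendsto_compose)
  then have "(\<lambda>n. eval_fps P (q ^ Suc (Suc n)) / eval_fps P q) \<longlonglongrightarrow> 1 / eval_fps P q"
    using pos P0 by (intro tendsto_divide) (auto simp: eval_fps_at_0)
  moreover have "eval_fps P (q ^ Suc (Suc n)) / eval_fps P q = (\<Prod>j\<le>n. 1 - eval_fps p (q ^ Suc j))" for n
    using prod[of "Suc n"] pos by (simp only: lessThan_Suc_atMost) (simp add: field_simps)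
  ultimately have "(\<lambda>n. \<Prod>j\<le>n. 1 - eval_fps p (q ^ Suc j)) \<longlonglongrightarrow> 1 / eval_fps P q"
    by simp
  then show "(\<lambda>j. 1 - eval_fps p (q ^ Suc j)) has_prod (1 / eval_fps P q)"
    using pos by (simp add: has_prod_def raw_has_prod_def)
qed

end

section \<open>Ratio limits of convolutions\<close>

lemma ratio_shift_tendsto_1:
  fixes u :: "nat \<Rightarrow> real"
  assumes ratio: "(\<lambda>n. u (Suc n) / u n) \<longlonglongrightarrow> 1" and pos: "\<forall>\<^sub>F n in sequentially. u n > 0"
  shows "(\<lambda>n. u n / u (n + m)) \<longlonglongrightarrow> 1"
proof (induction m)
  case 0
  have "\<forall>\<^sub>F n in sequentially. 1 = u n / u (n + 0)"
    using pos by eventually_elim auto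
  then show ?case by (rule Lim_transform_eventually[OF tendsto_const])
next
  case (Suc m)
  have "(\<lambda>n. (u n / u (n + m)) / (u (Suc (n + m)) / u (n + m))) \<longlonglongrightarrow> 1 / 1"
    by (intro tendsto_divide Suc LIMSEQ_ignore_initial_segment[OF ratio]) auto
  moreover have "\<forall>\<^sub>F n in sequentially. u (n + m) > 0"
    using pos by (rule eventually_sequentially_seg[THEN iffD2])
  then have "\<forall>\<^sub>F n in sequentially. (u n / u (n + m)) / (u (Suc (n + m)) / u (n + m)) = u n / u (n + Suc m)"
    by eventually_elim auto
  ultimately show ?case by (auto intro: Lim_transform_eventually)
qed

text \<open>A ratio limit 1 forces decay slower than any geometric sequence. The constant 1 / u_N
  also covers n - m < N, where u \<le> 1 and n - N < m.\<close>

lemma ratio_tendsto_1_growth: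
  fixes u :: "nat \<Rightarrow> real"
  assumes ratio: "(\<lambda>n. u (Suc n) / u n) \<longlonglongrightarrow> 1" and pos: "\<forall>\<^sub>F n in sequentially. u n > 0"
    and u: "\<And>n. 0 \<le> u n" "\<And>n. u n \<le> 1" and s: "s > 1"
  obtains C N where "C > 0" "\<And>n. n \<ge> N \<Longrightarrow> u n > 0"
    "\<And>n m. n \<ge> N \<Longrightarrow> m \<le> n \<Longrightarrow> u (n - m) \<le> C * s ^ m * u n"
proof -
  have "\<forall>\<^sub>F n in sequentially. u (Suc n) / u n > 1 / s"
    by (rule order_tendstoD[OF ratio]) (use s in auto)
  then have "\<forall>\<^sub>F n in sequentially. u n > 0 \<and> u n \<le> s * u (Suc n)"
    using pos by eventually_elim (use s in \<open>auto simp: field_simps\<close>)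
  then obtain N where N: "\<And>n. n \<ge> N \<Longrightarrow> u n > 0" "\<And>n. n \<ge> N \<Longrightarrow> u n \<le> s * u (Suc n)"
    by (auto simp: eventually_sequentially)
  have step: "u k \<le> s ^ j * u (k + j)" if "k \<ge> N" for k j
  proof (induction j)
    case (Suc j)
    have "s ^ j * u (k + j) \<le> s ^ j * (s * u (Suc (k + j)))"
      using that s by (intro mult_left_mono N) auto
    with Suc show ?case by (simp add: mult_ac)
  qed simp
  have uN: "1 / u N \<ge> 1" using u N(1)[of N] by simp
  have "u (n - m) \<le> 1 / u N * s ^ m * u n" if "n \<ge> N" "m \<le> n" for n m
  proof (cases "n - m \<ge> N")
    case True
    have "u (n - m) \<le> s ^ m * u n" using step[OF True, of m] that by simp
    also have "\<dots> \<le> 1 / u N * (s ^ m * u n)"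
      using uN s u(1)[of n] by (intro mult_right_mono[of 1 "1 / u N", simplified mult_1]) auto
    finally show ?thesis by simp
  next
    case False
    have "u (n - m) \<le> 1 / u N * u N" using u N(1)[of N] by simp
    also have "\<dots> \<le> 1 / u N * (s ^ (n - N) * u n)"
      using step[of N "n - N"] that uN u(1)[of N] by (intro mult_left_mono) auto
    also have "\<dots> \<le> 1 / u N * (s ^ m * u n)"
      using False that s uN u(1)[of n] u(1)[of N] by (intro mult_left_mono mult_right_mono power_increasing) auto
    finally show ?thesis by simp
  qed
  then show ?thesis using that[of "1 / u N" N] N(1) by auto
qed

text \<open>Each u_(n-m) / u_n tends to 1. For Tannery's theorem the growth bound (r / q)^m against
  q^m leaves the summable r^m, with q < r < 1.\<close>

lemma convolution_ratio_limit:
  fixes u d :: "nat \<Rightarrow> real"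
  assumes ratio: "(\<lambda>n. u (Suc n) / u n) \<longlonglongrightarrow> 1" and pos: "\<forall>\<^sub>F n in sequentially. u n > 0"
    and u: "\<And>n. 0 \<le> u n" "\<And>n. u n \<le> 1"
    and d: "\<And>m. \<bar>d m\<bar> \<le> M * q ^ m" and q: "0 < q" "q < 1"
  shows "(\<lambda>n. (\<Sum>m\<le>n. u (n - m) * d m) / u n) \<longlonglongrightarrow> (\<Sum>m. d m)"
proof -
  define r where "r = (1 + q) / 2"
  have r: "q < r" "0 < r" "r < 1" using q by (auto simp: r_def)
  have "r / q > 1" using r q by simp
  then obtain C N where C: "C > 0" and N: "\<And>n. n \<ge> N \<Longrightarrow> u n > 0"
    and bd: "\<And>n m. n \<ge> N \<Longrightarrow> m \<le> n \<Longrightarrow> u (n - m) \<le> C * (r / q) ^ m * u n"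
    using ratio_tendsto_1_growth[OF ratio pos u] by metis
  define a where "a m n = (if m \<le> n then u (n - m) / u n * d m else 0)" for m n
  have lim: "(\<lambda>n. a m (n + N)) \<longlonglongrightarrow> d m" for m
  proof -
    have "(\<lambda>n. u n / u (n + m) * d m) \<longlonglongrightarrow> 1 * d m"
      by (intro tendsto_mult ratio_shift_tendsto_1 ratio pos tendsto_const)
    then have "(\<lambda>n. a m (n + m)) \<longlonglongrightarrow> d m" by (simp add: a_def)
    then have "(\<lambda>n. a m n) \<longlonglongrightarrow> d m" by (rule LIMSEQ_offset)
    then show ?thesis by (rule LIMSEQ_ignore_initial_segment)
  qed
  have "M \<ge> 0" using d[of 0] by simp
  have bound: "norm (a m (n + N)) \<le> C * M * r ^ m" for m n
  proof (cases "m \<le> n + N")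
    case True
    have "u (n + N - m) / u (n + N) \<le> C * (r / q) ^ m"
      using bd[of "n + N" m] N[of "n + N"] True by (simp add: field_simps)
    then have "u (n + N - m) / u (n + N) * \<bar>d m\<bar> \<le> C * (r / q) ^ m * (M * q ^ m)"
      using d C r q by (intro mult_mono) auto
    also have "\<dots> = C * M * r ^ m" using q by (simp add: power_divide)
    finally show ?thesis using True u N[of "n + N"] by (simp add: a_def abs_mult)
  qed (use C \<open>M \<ge> 0\<close> r in \<open>auto simp: a_def\<close>)
  have "(\<lambda>n. \<Sum>m. a m (n + N)) \<longlonglongrightarrow> (\<Sum>m. d m)"
    using tannerys_theorem[of "\<lambda>m n. a m (n + N)" d sequentially "\<lambda>m. C * M * r ^ m"] lim bound r
    by (auto intro!: always_eventually summable_mult summable_geometric)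
  then have "(\<lambda>n. \<Sum>m. a m n) \<longlonglongrightarrow> (\<Sum>m. d m)" by (rule LIMSEQ_offset)
  moreover have "(\<Sum>m. a m n) = (\<Sum>m\<le>n. u (n - m) * d m) / u n" for n
    by (subst suminf_finite[of "{..n}"]) (auto simp: a_def sum_divide_distrib)
  ultimately show ?thesis by simp
qed

text \<open>In the convolution identity the weights \<open>q\<^bsup>n(N-n)\<^esup>\<close> are at most \<open>q\<^bsup>N-1\<^esup>\<close> for \<open>0 < n < N\<close>,
  so only the term \<open>n = N\<close> matters.\<close>

lemma q_convolution_limit:
  fixes b P u :: "nat \<Rightarrow> real"
  assumes ratio: "(\<lambda>n. u (Suc n) / u n) \<longlonglongrightarrow> 1" and pos: "\<forall>\<^sub>F n in sequentially. u n > 0"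
    and u: "\<And>n. 0 \<le> u n" "\<And>n. u n \<le> 1" "u 0 = 1" and q: "0 < q" "q < 1"
    and P: "\<And>n. 0 \<le> P n" "\<And>n. P n \<le> M" "P 0 = 1" and b: "\<And>n. 0 \<le> b n" "b 0 = 0"
    and z: "\<zeta> > 0"
    and conv: "\<And>N. \<zeta> * P N = (\<Sum>n\<le>Suc N. b n * q ^ (n * (Suc N - n)) * P (Suc N - n))"
    and lim: "(\<lambda>n. P n / u n) \<longlonglongrightarrow> l"
  shows "(\<lambda>n. b n / u n) \<longlonglongrightarrow> \<zeta> * l"
proof -
  have M: "M \<ge> 1" using P(2)[of 0] P(3) by simp
  have split: "\<zeta> * P N = b (Suc N) + (\<Sum>n\<le>N. b n * q ^ (n * (Suc N - n)) * P (Suc N - n))" for N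
    unfolding conv using P(3) by simp
  have nn: "b n * q ^ k * P m \<ge> 0" for n k m using b P q by simp
  have b_le: "b n \<le> \<zeta> * M" for n
  proof (cases n)
    case 0
    then show ?thesis using b z M by simp
  next
    case (Suc N)
    have "b (Suc N) \<le> \<zeta> * P N" unfolding split using nn by (simp add: sum_nonneg)
    also have "\<dots> \<le> \<zeta> * M" using P z by (intro mult_left_mono) auto
    finally show ?thesis using Suc by simp
  qed
  have err: "\<bar>\<zeta> * P N - b (Suc N)\<bar> \<le> (real N + 1) * (\<zeta> * M * q ^ N * M)" for N
  proof -
    have "b n * q ^ (n * (Suc N - n)) * P (Suc N - n) \<le> \<zeta> * M * q ^ N * M" if nN: "n \<le> N" for n
    proof (cases "n = 0")
      case True
      then show ?thesis using b z M q by simp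
    next
      case False
      then obtain a where a: "n = Suc a" using not0_implies_Suc by blast
      obtain c where c: "N = n + c" using nN le_Suc_ex by blast
      \<comment> \<open>In terms of a = n - 1 and c = N - n: (a + 1) (c + 1) = N + a c.\<close>
      have "n * (Suc N - n) = N + a * c" unfolding c unfolding a by (simp add: algebra_simps)
      then have "q ^ (n * (Suc N - n)) \<le> q ^ N" using q by (intro power_decreasing) auto
      then show ?thesis
        using b b_le P z M q by (intro mult_mono) auto
    qed
    then have "(\<Sum>n\<le>N. b n * q ^ (n * (Suc N - n)) * P (Suc N - n)) \<le> (\<Sum>n\<le>N. \<zeta> * M * q ^ N * M)"
      by (intro sum_mono) auto
    moreover have "0 \<le> (\<Sum>n\<le>N. b n * q ^ (n * (Suc N - n)) * P (Suc N - n))"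
      using nn by (intro sum_nonneg) auto
    ultimately show ?thesis unfolding split by (simp add: algebra_simps)
  qed
  define r where "r = (1 + q) / 2"
  have r: "q < r" "0 < r" "r < 1" using q by (auto simp: r_def)
  have "r / q > 1" using r q by simp
  then obtain C N0 where C: "C > 0" and N0: "\<And>n. n \<ge> N0 \<Longrightarrow> u n > 0"
    and bd: "\<And>n m. n \<ge> N0 \<Longrightarrow> m \<le> n \<Longrightarrow> u (n - m) \<le> C * (r / q) ^ m * u n"
    using ratio_tendsto_1_growth[OF ratio pos u(1,2)] by metis
  have "(\<lambda>N. (\<zeta> * P N - b (Suc N)) / u N) \<longlonglongrightarrow> 0"
  proof (rule Lim_null_comparison)
    show "\<forall>\<^sub>F N in sequentially. norm ((\<zeta> * P N - b (Suc N)) / u N) \<le> (\<zeta> * M * M * C) * ((real N + 1) * r ^ N)"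
      using eventually_ge_at_top[of N0]
    proof eventually_elim
      case (elim N)
      have uN: "u N > 0" using N0 elim by simp
      \<comment> \<open>The growth bound with m = n and u_0 = 1 bounds u_N below by a multiple of (q
        / r)^N; the error of order N q^N becomes N r^N after division.\<close>
      have "1 \<le> C * (r / q) ^ N * u N" using bd[OF elim order_refl] u(3) by simp
      then have 1: "1 / u N \<le> C * (r / q) ^ N" using uN by (simp add: field_simps)
      have "norm ((\<zeta> * P N - b (Suc N)) / u N) = \<bar>\<zeta> * P N - b (Suc N)\<bar> * (1 / u N)"
        using uN by simp
      also have "\<dots> \<le> ((real N + 1) * (\<zeta> * M * q ^ N * M)) * (C * (r / q) ^ N)"
        using err 1 uN z M q by (intro mult_mono) auto
      also have "\<dots> = (\<zeta> * M * M * C) * ((real N + 1) * r ^ N)"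
        using q by (simp add: power_divide)
      finally show ?case .
    qed
    have "(\<lambda>N. real N * r ^ N + r ^ N) \<longlonglongrightarrow> 0 + 0"
      using r by (intro tendsto_add powser_times_n_limit_0 LIMSEQ_realpow_zero) auto
    then show "(\<lambda>N. (\<zeta> * M * M * C) * ((real N + 1) * r ^ N)) \<longlonglongrightarrow> 0"
      by (intro tendsto_mult_right_zero) (simp add: distrib_right)
  qed
  then have "(\<lambda>N. \<zeta> * (P N / u N) - (\<zeta> * P N - b (Suc N)) / u N) \<longlonglongrightarrow> \<zeta> * l - 0"
    by (intro tendsto_diff tendsto_mult lim tendsto_const)
  then have "(\<lambda>N. b (Suc N) / u N) \<longlonglongrightarrow> \<zeta> * l"
    by (simp add: diff_divide_distrib)
  from tendsto_divide[OF this ratio] have "(\<lambda>N. (b (Suc N) / u N) / (u (Suc N) / u N)) \<longlonglongrightarrow> \<zeta> * l"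
    by simp
  moreover have "\<forall>\<^sub>F N in sequentially. (b (Suc N) / u N) / (u (Suc N) / u N) = b (Suc N) / u (Suc N)"
    using pos by eventually_elim auto
  ultimately have "(\<lambda>N. b (Suc N) / u (Suc N)) \<longlonglongrightarrow> \<zeta> * l"
    by (rule Lim_transform_eventually)
  then show ?thesis by (rule LIMSEQ_imp_Suc)
qed

section \<open>The pointwise limit and the three modes of convergence\<close>

lemma density_zero_of_tendsto:
  fixes x :: "nat \<Rightarrow> real"
  assumes "x \<longlonglongrightarrow> l" "\<delta> > 0"
  shows "(\<lambda>n. real (card {i \<in> {1..n}. \<bar>x i - l\<bar> \<ge> \<delta>}) / real n) \<longlonglongrightarrow> 0"
proof -
  obtain N where N: "\<And>i. i \<ge> N \<Longrightarrow> \<bar>x i - l\<bar> < \<delta>"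
    using LIMSEQ_D[OF assms] by auto
  have "card {i \<in> {1..n}. \<bar>x i - l\<bar> \<ge> \<delta>} \<le> N" for n
  proof -
    have "{i \<in> {1..n}. \<bar>x i - l\<bar> \<ge> \<delta>} \<subseteq> {..<N}"
      using N by (auto simp: not_less[symmetric] intro: leI)
    then show ?thesis using card_mono[of "{..<N}"] by fastforce
  qed
  then have "norm (real (card {i \<in> {1..n}. \<bar>x i - l\<bar> \<ge> \<delta>}) / real n) \<le> real N / real n" for n
    by (simp add: divide_right_mono)
  then show ?thesis
    by (intro Lim_null_comparison[OF always_eventually lim_const_over_n]) auto
qed

lemma eval_fps_dilate: "eval_fps (fps_dilate c h) x = eval_fps h (c * x)"
  by (simp add: eval_fps_def power_mult_distrib mult_ac)

text \<open>With S_n = 1 / (1 - \<phi>(\<zeta>(1 - 1/n))) and the factor \<zeta>^n included in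
  \<open>b n\<close>, the sequence is the quotient of b_n / u_n by S_n / (n u_n), which tend to
  \<zeta> P(q) and Gamma(\<rho>).\<close>

theorem q_inverse_pointwise_limit:
  fixes \<phi> :: "real fps" and \<zeta> \<rho> q :: real and g :: "real fps"
  assumes phi0: "fps_nth \<phi> 0 = 0"
    and sp: "subprobability_fps (fps_dilate \<zeta> \<phi>)" and zeta: "\<zeta> > 0"
    and inv: "is_q_inverse q (fps_X * (1 - \<phi>)) g" and q: "0 < q" "q < 1"
    and g_nonneg: "\<And>n. q ^ (n choose 2) * fps_nth g n \<ge> 0"
    and rho: "0 < \<rho>" "\<rho> \<le> 1"
    and rv: "regularly_varying (fps_nth (inverse (1 - fps_dilate \<zeta> \<phi>))) (\<rho> - 1)"
  shows "(\<lambda>n. \<zeta> ^ n * real n * (1 - eval_fps \<phi> (\<zeta> * (1 - 1 / real n))) *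
      (q ^ (n choose 2) * fps_nth g n)) \<longlonglongrightarrow> L_fun \<phi> \<zeta> \<rho> q"
proof -
  define p where "p = fps_dilate \<zeta> \<phi>"
  interpret subprobability_fps p using sp by (simp add: p_def)
  define u where "u = fps_nth (inverse (1 - p))"
  have u: "0 \<le> u n" "u n \<le> 1" "u 0 = 1" for n
    using renewal_bounds[of n] renewal_nth_0 by (auto simp: u_def)
  have rv': "regularly_varying u (\<rho> - 1)" using rv by (simp add: u_def p_def)
  have pos: "\<forall>\<^sub>F n in sequentially. u n > 0"
    by (rule regularly_varying_eventually_pos[OF rv' u(1)])
  have ratio: "(\<lambda>n. u (Suc n) / u n) \<longlonglongrightarrow> 1"
    by (rule regularly_varying_Suc_ratio[OF rv'])
  obtain P1 where P1: "fps_nth P1 0 = 1" "(1 - \<phi>) * P1 = fps_dilate q P1"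
    using q_eigen_exists[OF phi0 q] by metis
  \<comment> \<open>Rescaling by \<zeta> turns the equation with \<phi> into the one with p, so
    \<open>eval_fps P q\<close> is the value of \<open>P1\<close> at \<zeta> q.\<close>
  define P where "P = fps_dilate \<zeta> P1"
  have "1 - p = fps_dilate \<zeta> (1 - \<phi>)" unfolding p_def by (rule fps_ext) (simp add: algebra_simps)
  then have P: "fps_nth P 0 = 1" "(1 - p) * P = fps_dilate q P"
    using P1 by (simp_all add: P_def fps_dilate_dilate mult.commute flip: fps_dilate_mult)
  note bd = eigen_bounded[OF q P]
  define M where "M = exp (1 / (1 - q) ^ 2)"
  have P_lim: "(\<lambda>n. fps_nth P n / u n) \<longlonglongrightarrow> eval_fps P q"
  proof -
    have "(\<lambda>n. (\<Sum>m\<le>n. u (n - m) * (q ^ m * fps_nth P m)) / u n) \<longlonglongrightarrow> (\<Sum>m. q ^ m * fps_nth P m)"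
      by (rule convolution_ratio_limit[OF ratio pos u(1,2) _ q, where M = M])
        (use bd q in \<open>auto simp: M_def abs_mult mult.commute\<close>)
    moreover have "(\<Sum>m\<le>n. u (n - m) * (q ^ m * fps_nth P m)) = fps_nth P n" for n
      by (subst (2) eigen_renewal[OF q P], subst mult.commute)
        (simp add: fps_mult_nth atLeast0AtMost u_def mult.commute)
    ultimately show ?thesis by (simp add: eval_fps_def mult.commute)
  qed
  define b where "b n = \<zeta> ^ n * (q ^ (n choose 2) * fps_nth g n)" for n
  have f: "fps_nth (fps_X * (1 - \<phi>)) 0 = 0" "fps_nth (fps_X * (1 - \<phi>)) 1 = 1"
    using phi0 by simp_all
  have "q \<noteq> 0" using q by simp
  then have dual: "fps_qsubst q (fps_X * (1 - \<phi>)) g = fps_X"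
    by (rule q_lagrange_duality[OF inv f])
  have b_lim: "(\<lambda>n. b n / u n) \<longlonglongrightarrow> \<zeta> * eval_fps P q"
  proof (rule q_convolution_limit[OF ratio pos u q _ _ P(1) _ _ zeta _ P_lim, where M = M])
    show "b 0 = 0" using inv by (simp add: b_def is_q_inverse_def)
    show "0 \<le> b n" for n using g_nonneg zeta by (simp add: b_def)
    show "\<zeta> * fps_nth P N =
        (\<Sum>n\<le>Suc N. b n * q ^ (n * (Suc N - n)) * fps_nth P (Suc N - n))" for N
    proof -
      \<comment> \<open>The factor X shifts N to N + 1 and accounts for the extra \<zeta>; the power
        \<zeta>^(N+1) is then split between \<open>b\<close> and \<open>P\<close>.\<close>
      have "\<zeta> * fps_nth P N = \<zeta> ^ Suc N * fps_nth (fps_X * P1) (Suc N)"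
        by (simp add: P_def)
      also have "\<dots> = (\<Sum>n\<le>Suc N. \<zeta> ^ Suc N * (q ^ (n choose 2) * fps_nth g n * q ^ (n * (Suc N - n)) * fps_nth P1 (Suc N - n)))"
        unfolding q_inverse_convolution[OF dual P1(2)] by (rule sum_distrib_left)
      also have "\<dots> = (\<Sum>n\<le>Suc N. b n * q ^ (n * (Suc N - n)) * fps_nth P (Suc N - n))"
      proof (rule sum.cong[OF refl])
        fix n assume "n \<in> {..Suc N}"
        then have "\<zeta> ^ Suc N = \<zeta> ^ n * \<zeta> ^ (Suc N - n)"
          by (simp only: power_add[symmetric] le_add_diff_inverse atMost_iff)
        then show "\<zeta> ^ Suc N * (q ^ (n choose 2) * fps_nth g n * q ^ (n * (Suc N - n)) * fps_nth P1 (Suc N - n)) =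
            b n * q ^ (n * (Suc N - n)) * fps_nth P (Suc N - n)"
          by (simp only: b_def P_def fps_dilate_nth mult_ac)
      qed
      finally show ?thesis .
    qed
  qed (use bd in \<open>auto simp: M_def\<close>)
  define S where "S n = (\<Sum>k. u k * (1 - 1 / real n) ^ k)" for n
  have S_lim: "(\<lambda>n. S n / (real n * u n)) \<longlonglongrightarrow> Gamma \<rho>"
    using Karamata_Abel[OF rv' u(1,2)] rho by (simp add: S_def)
  have "Gamma \<rho> > 0" using rho by (intro Gamma_real_pos) auto
  have "(\<lambda>n. (b n / u n) / (S n / (real n * u n))) \<longlonglongrightarrow> \<zeta> * eval_fps P q / Gamma \<rho>"
    using \<open>Gamma \<rho> > 0\<close> by (intro tendsto_divide b_lim S_lim) auto
  moreover have "\<zeta> * eval_fps P q / Gamma \<rho> = L_fun \<phi> \<zeta> \<rho> q"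
  proof -
    have "(\<lambda>j. 1 - eval_fps \<phi> (\<zeta> * q ^ Suc j)) has_prod (1 / eval_fps P q)"
      using eigen_eval_has_prod(1)[OF q P] by (simp only: p_def eval_fps_dilate)
    then have "(\<Prod>j. 1 - eval_fps \<phi> (\<zeta> * q ^ Suc j)) = 1 / eval_fps P q"
      by (rule has_prod_unique[symmetric])
    then show ?thesis by (simp only: L_fun_def) simp
  qed
  moreover have "\<forall>\<^sub>F n in sequentially. (b n / u n) / (S n / (real n * u n)) =
      \<zeta> ^ n * real n * (1 - eval_fps \<phi> (\<zeta> * (1 - 1 / real n))) * (q ^ (n choose 2) * fps_nth g n)"
    using pos eventually_gt_at_top[of 0]
  proof eventually_elim
    case (elim n)
    have "\<bar>1 - 1 / real n\<bar> < 1" using elim(2) by (simp add: abs_if)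
    then have "(1 - eval_fps p (1 - 1 / real n)) * S n = 1"
      unfolding S_def u_def by (rule renewal_eval)
    then have S: "(1 - eval_fps \<phi> (\<zeta> * (1 - 1 / real n))) * S n = 1"
      by (simp only: p_def eval_fps_dilate)
    then have "S n \<noteq> 0" by auto
    with S have "1 - eval_fps \<phi> (\<zeta> * (1 - 1 / real n)) = 1 / S n"
      by (simp only: eq_divide_eq) simp
    then show ?case using elim by (simp add: b_def)
  qed
  ultimately show ?thesis by (auto intro: Lim_transform_eventually)
qed

theorem theorem2p4:
  fixes \<phi> :: "real fps" and \<zeta> \<rho> :: real and g :: "real \<Rightarrow> real fps"
  assumes phi0: "fps_nth \<phi> 0 = 0"
    and g: "\<And>q. 0 < q \<Longrightarrow> q < 1 \<Longrightarrow> is_q_inverse q (fps_X * (1 - \<phi>)) (g q)"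
    and nonneg: "\<And>i. i \<ge> 1 \<Longrightarrow> fps_nth \<phi> i \<ge> 0"
    and zeta: "is_min_unit_root \<phi> \<zeta>"
    and ratio: "has_ratio_limits (fps_nth \<phi>)"
    and rho: "\<rho> - 1 \<in> {-1<..0}"
    and rv: "regularly_varying (fps_nth (inverse (1 - fps_dilate \<zeta> \<phi>))) (\<rho> - 1)"
  shows "\<exists>(a :: nat \<Rightarrow> real poly) (L :: real fps).
           (\<forall>n. represents_poly (a n) (a_fun \<phi> \<zeta> g n)) \<and>
           represents_fps L (L_fun \<phi> \<zeta> \<rho>) \<and>
           converges_liminf a L {0<..<1} \<and>
           converges_off_density_zero a L {0<..<1} \<and>
           converges_coeffwise a L"
proof -
  define p where "p = fps_dilate \<zeta> \<phi>"
  have z: "\<zeta> > 0" and sum1: "(\<lambda>n. fps_nth p n) sums 1"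
    using zeta by (auto simp: is_min_unit_root_def Let_def p_def mult.commute)
  have phi_nonneg: "fps_nth \<phi> i \<ge> 0" for i
    using nonneg[of i] phi0 by (cases "i = 0") auto
  have sp: "subprobability_fps p"
  proof
    show "fps_nth p 0 = 0" using phi0 by (simp add: p_def)
    show nn: "fps_nth p i \<ge> 0" for i using phi_nonneg z by (simp add: p_def)
    show "(\<Sum>i\<le>n. fps_nth p i) \<le> 1" for n
      using sum_le_suminf[OF sums_summable[OF sum1], of "{..n}"] nn sums_unique[OF sum1] by simp
  qed
  interpret subprobability_fps p by (rule sp)
  have "\<exists>p. (\<forall>i. coeff p i \<ge> 0) \<and> represents_poly p (\<lambda>q. q ^ (n choose 2) * fps_nth (g q) n)" for n
    using nonneg_poly_q_inverse[OF phi0 phi_nonneg g] by (simp add: nonneg_poly_on_unit_def)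
  then obtain A where A: "\<And>n i. coeff (A n) i \<ge> 0"
      "\<And>n. represents_poly (A n) (\<lambda>q. q ^ (n choose 2) * fps_nth (g q) n)"
    by metis
  have A_eq: "poly (A n) q = q ^ (n choose 2) * fps_nth (g q) n" if "0 < q" "q < 1" for n q
    using A(2)[of n] that by (simp add: represents_poly_def)
  define c where "c n = \<zeta> ^ n * real n * (1 - eval_fps \<phi> (\<zeta> * (1 - 1 / real n)))" for n
  \<comment> \<open>Keeps the coefficients of \<open>a n\<close> nonnegative, as the coefficientwise
    limit requires. For n > 0 the last factor has product 1 with a nonnegative sum.\<close>
  have c: "c n \<ge> 0" for n
  proof (cases "n = 0")
    case False
    define x where "x = 1 - 1 / real n"
    have x: "0 \<le> x" "\<bar>x\<bar> < 1" using False by (auto simp: x_def abs_if)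
    have S: "(1 - eval_fps p x) * (\<Sum>k. fps_nth (inverse (1 - p)) k * x ^ k) = 1"
      by (rule renewal_eval[OF x(2)])
    have "summable (\<lambda>k. fps_nth (inverse (1 - p)) k * x ^ k)"
    proof (rule summable_comparison_test')
      show "summable (\<lambda>k. x ^ k)" using x by (intro summable_geometric) auto
      show "norm (fps_nth (inverse (1 - p)) k * x ^ k) \<le> x ^ k" if "k \<ge> 0" for k
        using renewal_bounds[of k] x by (simp add: abs_mult mult_left_le_one_le)
    qed
    then have "0 \<le> (\<Sum>k. fps_nth (inverse (1 - p)) k * x ^ k)"
      using renewal_bounds x by (intro suminf_nonneg) auto
    with S have "1 - eval_fps p x \<ge> 0"
      by (metis linorder_not_le mult_nonpos_nonneg less_imp_le zero_less_one not_le)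
    then show ?thesis using z by (simp add: c_def x_def p_def eval_fps_dilate)
  qed (simp add: c_def)
  define a where "a n = smult (c n) (A n)" for n
  have a_eq: "poly (a n) q = c n * (q ^ (n choose 2) * fps_nth (g q) n)" if "0 < q" "q < 1" for n q
    using A_eq[OF that] by (simp add: a_def)
  have lim: "(\<lambda>n. poly (a n) q) \<longlonglongrightarrow> L_fun \<phi> \<zeta> \<rho> q" if q: "0 < q" "q < 1" for q
  proof -
    have "q ^ (n choose 2) * fps_nth (g q) n \<ge> 0" for n
      unfolding A_eq[OF q, symmetric] poly_altdef using A(1) q by (intro sum_nonneg) auto
    from q_inverse_pointwise_limit[OF phi0 sp[unfolded p_def] z g[OF q] q this _ _ rv] rho
    show ?thesis by (simp add: a_eq[OF q] c_def)
  qed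
  \<comment> \<open>L arises as the coefficientwise limit of the polynomials, not by expanding the
    infinite product.\<close>
  obtain L where L: "\<And>j. (\<lambda>n. coeff (a n) j) \<longlonglongrightarrow> fps_nth L j"
      "\<And>q. 0 < q \<Longrightarrow> q < 1 \<Longrightarrow> (\<lambda>j. fps_nth L j * q ^ j) sums L_fun \<phi> \<zeta> \<rho> q"
    using nonneg_poly_pointwise_limit[of a "L_fun \<phi> \<zeta> \<rho>"] lim A(1) c by (auto simp: a_def)
  have L_eval: "eval_fps L q = L_fun \<phi> \<zeta> \<rho> q" if "0 < q" "q < 1" for q
    using sums_unique[OF L(2)[OF that]] by (simp add: eval_fps_def)
  show ?thesis
  proof (intro exI conjI)
    show "\<forall>n. represents_poly (a n) (a_fun \<phi> \<zeta> g n)"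
      using a_eq by (auto simp: represents_poly_def a_fun_def c_def)
    show "represents_fps L (L_fun \<phi> \<zeta> \<rho>)"
      using L(2) by (simp add: represents_fps_def)
    \<comment> \<open>The whole sequence converges pointwise, so this and the density statement are
      weakenings of \<open>lim\<close>.\<close>
    show "converges_liminf a L {0<..<1}"
      using lim by (auto simp: converges_liminf_def L_eval intro!: lim_imp_Liminf)
    show "converges_off_density_zero a L {0<..<1}"
      unfolding converges_off_density_zero_def
    proof (intro allI impI ballI)
      fix \<delta> q :: real assume "\<delta> > 0" "q \<in> {0<..<1}"
      then show "(\<lambda>n. real (card {i \<in> {1..n}. \<bar>poly (a i) q - eval_fps L q\<bar> \<ge> \<delta>}) / real n) \<longlonglongrightarrow> 0"
        by (intro density_zero_of_tendsto) (simp_all add: L_eval lim)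
    qed
    show "converges_coeffwise a L"
      using L(1) by (simp add: converges_coeffwise_def)
  qed
qed

end
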